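(* Let $\bm{L}\in\mathbb{R}^{m\times n}$ have rank $r$ and compact SVD $\bm{L}=\bm{W}_{\bm{L}}\bm{\Sigma}_{\bm{L}}\bm{V}_{\bm{L}}^T$, and suppose $\max_{i}\|\bm{W}_{\bm{L}}^T\bm{e}_i\|_2\leq\sqrt{\mu_1(\bm{L}) r/m}$ and $\max_{i}\|\bm{V}_{\bm{L}}^T\bm{e}_i\|_2\leq\sqrt{\mu_2(\bm{L}) r/n}$. Suppose $J\subseteq[n]$ is chosen by sampling uniformly without replacement, with $|J|\geq\gamma\mu_2(\bm{L})r$ for some $\gamma>0$, and let $\bm{C}=\bm{L}(:,J)$ with compact SVD $\bm{C}=\bm{W}_{\bm{C}}\bm{\Sigma}_{\bm{C}}\bm{V}_{\bm{C}}^T$. Let $\delta\in[0,1)$. Then with probability at least $1-\frac{r}{e^{\gamma(\delta+(1-\delta)\log(1-\delta))}}$ the quantity $\beta=\sqrt{|J|/n}\,\|(\bm{V}_{\bm{L}}(J,:))^\dagger\|_2$ satisfies \begin{enumerate} \item $\beta\leq\frac{1}{\sqrt{1-\delta}}$, \item $\max_i\|\bm{V}_{\bm{C}}^T\bm{e}_i\|_2\leq\beta\,\kappa(\bm{L})\sqrt{\frac{\mu_2(\bm{L})r}{|J|}}$, and \item $\kappa(\bm{C})\leq\beta\sqrt{\mu_2(\bm{L}) r}\,\kappa(\bm{L})$. \end{enumerate} In particular, with the same probability, $\mu_1(\bm{C})\leq\mu_1(\bm{L})$ and $\mu_2(\bm{C})\leq\beta^2\kappa(\bm{L})^2\mu_2(\bm{L})$,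 i.e. $\max_i\|\bm{W}_{\bm{C}}^T\bm{e}_i\|_2\le\sqrt{\mu_1(\bm{L})r/m}$ and $\max_i\|\bm{V}_{\bm{C}}^T\bm{e}_i\|_2\le\sqrt{\beta^2\kappa(\bm{L})^2\mu_2(\bm{L})r/|J|}$.
   Context: $[n]=\{1,\dots,n\}$; $\bm{A}(I,J)$ denotes a submatrix (":" meaning all indices); $\bm{A}^\dagger$ is the Moore–Penrose pseudoinverse; $\kappa(\bm{A})=\sigma_{\max}(\bm{A})/\sigma_{\min}(\bm{A})$ with $\sigma_{\min}$ the smallest nonzero singular value; $\bm{e}_i$ is a canonical basis vector; $\log$ is the natural logarithm. Incoherence parameters $\mu_1(\bm{C}),\mu_2(\bm{C})$ of $\bm{C}\in\mathbb{R}^{m\times|J|}$ are the constants in $\max_i\|\bm{W}_{\bm{C}}^T\bm{e}_i\|_2\le\sqrt{\mu_1(\bm{C})r/m}$ and $\max_i\|\bm{V}_{\bm{C}}^T\bm{e}_i\|_2\le\sqrt{\mu_2(\bm{C})r/|J|}$. *)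

theory Defs
  imports "Jordan_Normal_Form.DL_Rank" "Jordan_Normal_Form.DL_Submatrix"
    "Jordan_Normal_Form.Char_Poly" "HOL-Probability.Probability_Mass_Function"
begin

(* Matrices are Jordan_Normal_Form matrices; indices are 0-based, so [n] = {..<n}. *)

definition vnorm2 :: "real Matrix.vec \<Rightarrow> real" where
  "vnorm2 v = sqrt (\<Sum>i<dim_vec v. (v $ i)^2)"

definition spec_norm :: "real Matrix.mat \<Rightarrow> real" where
  "spec_norm A = Sup {vnorm2 (A *\<^sub>v x) | x. x \<in> carrier_vec (dim_col A) \<and> vnorm2 x \<le> 1}"

definition is_pinv :: "real Matrix.mat \<Rightarrow> real Matrix.mat \<Rightarrow> bool" where
  "is_pinv A B \<longleftrightarrow> B \<in> carrier_mat (dim_col A) (dim_row A) \<and>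
     A * B * A = A \<and> B * A * B = B \<and>
     transpose_mat (A * B) = A * B \<and> transpose_mat (B * A) = B * A"

definition pinv :: "real Matrix.mat \<Rightarrow> real Matrix.mat" where
  "pinv A = (SOME B. is_pinv A B)"

definition sing_vals :: "real Matrix.mat \<Rightarrow> real set" where
  "sing_vals A = {s. s > 0 \<and> eigenvalue (transpose_mat A * A) (s^2)}"

definition cond_num :: "real Matrix.mat \<Rightarrow> real" where
  "cond_num A = Max (sing_vals A) / Min (sing_vals A)"

definition compact_svd :: "real Matrix.mat \<Rightarrow> real Matrix.mat \<Rightarrow> real Matrix.mat \<Rightarrow> real Matrix.mat \<Rightarrow> nat \<Rightarrow> bool" where
  "compact_svd A W S V r \<longleftrightarrow>
     W \<in> carrier_mat (dim_row A) r \<and> S \<in> carrier_mat r r \<and> V \<in> carrier_mat (dim_col A) r \<and>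
     transpose_mat W * W = 1\<^sub>m r \<and> transpose_mat V * V = 1\<^sub>m r \<and>
     (\<forall>i<r. \<forall>j<r. i \<noteq> j \<longrightarrow> S $$ (i,j) = 0) \<and>
     (\<forall>i<r. S $$ (i,i) > 0) \<and>
     (\<forall>i j. i \<le> j \<and> j < r \<longrightarrow> S $$ (j,j) \<le> S $$ (i,i)) \<and>
     A = W * S * transpose_mat V"

end

theory Submission
  imports Defs "HOL-Real_Asymp.Real_Asymp"
begin

text \<open>
  Everything follows deterministically once the smallest eigenvalue of
  \<open>\<Sum>\<^sub>j\<^sub>\<in>\<^sub>J x\<^sub>j x\<^sub>j\<^sup>T\<close> is at least \<open>(1 - \<delta>)k/n\<close>, where the \<open>x\<^sub>j\<close> are the rows of \<open>V\<^sub>L\<close>: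
  since \<open>C = W\<^sub>L \<Sigma>\<^sub>L V\<^sub>L(J,:)\<^sup>T\<close>, all singular values of \<open>C\<close> lie between
  \<open>\<sigma>\<^sub>m\<^sub>i\<^sub>n(L) / \<parallel>V\<^sub>L(J,:)\<^sup>\<dagger>\<parallel>\<close> and \<open>\<sigma>\<^sub>m\<^sub>a\<^sub>x(L) \<parallel>V\<^sub>L(J,:)\<parallel>\<close>.

  The eigenvalue bound is a matrix Chernoff inequality for sampling without replacement, obtained from the
  potential \<open>\<phi>(J) = tr exp (-\<theta> S\<^sub>J)\<close> with \<open>S\<^sub>J = \<Sum>\<^sub>j\<^sub>\<in>\<^sub>J x\<^sub>j x\<^sub>j\<^sup>T\<close>. Adding one row lowers it by at
  least \<open>c x\<^sup>T exp (-\<theta> S\<^sub>J) x\<close> with \<open>c = (1 - exp (-\<theta>M)) / M\<close> (the rank-one case of the Golden-Thompson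
  inequality, proved here by splitting the update into \<open>N\<close> equal parts and letting \<open>N\<close> tend to infinity).
  Exchanging \<open>x \<in> J\<close> for \<open>y \<notin> J\<close> is an involution, and \<open>tr ((A - B) (exp (-\<theta>A) - exp (-\<theta>B))) \<le> 0\<close>, so on
  average the rows outside \<open>J\<close> contribute at least as much as those inside. As the \<open>x\<^sub>j\<close> form a
  Parseval frame, the mean potential drops by a factor \<open>1 - c/n\<close> per sampled row.
\<close>

no_notation inner (infix "\<bullet>" 70)
no_notation vec_nth (infixl "$" 90)

subsection \<open>The spectral theorem for real symmetric matrices\<close>

text \<open>Over the complex numbers the characteristic polynomial splits. For a complex eigenvector
  \<open>v\<close> the form v* A v equals the eigenvalue times |v|^2, and symmetry makes this form
  real.\<close>

lemma sym_eigenvalue_exists: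
  fixes A :: "real Matrix.mat"
  assumes A: "A \<in> carrier_mat n n" and sym: "transpose_mat A = A" and n: "n > 0"
  shows "\<exists>a. eigenvalue A a"
proof -
  let ?C = "map_mat complex_of_real A"
  have C: "?C \<in> carrier_mat n n" using A by auto
  obtain as where as: "char_poly ?C = (\<Prod>a\<leftarrow>as. [:- a, 1:])" "length as = n"
    using char_poly_factorized[OF C] by auto
  with n obtain z where "z \<in> set as" by (cases as) auto
  then have root: "poly (char_poly ?C) z = 0"
    unfolding as by (auto simp: poly_prod_list prod_list_zero_iff)
  then obtain v where v: "v \<in> carrier_vec n" "v \<noteq> 0\<^sub>v n" "?C *\<^sub>v v = z \<cdot>\<^sub>v v"
    using eigenvalue_root_char_poly[OF C] A unfolding eigenvalue_def eigenvector_def by auto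
  have Cv: "(\<Sum>j<n. complex_of_real (A $$ (i,j)) * v $ j) = z * v $ i" if "i < n" for i
    using arg_cong[OF v(3), of "\<lambda>w. w $ i"] that v(1) A
    by (auto simp: scalar_prod_def lessThan_atLeast0)
  have symA: "A $$ (i,j) = A $$ (j,i)" if "i < n" "j < n" for i j
    using arg_cong[OF sym, of "\<lambda>B. B $$ (j,i)"] that A by auto
  define q where "q = (\<Sum>i<n. cnj (v $ i) * (v $ i))"
  have q: "q = complex_of_real (\<Sum>i<n. (cmod (v $ i))\<^sup>2)"
    unfolding q_def of_real_sum by (intro sum.cong refl) (metis complex_norm_square mult.commute of_real_power)
  have "z * q = (\<Sum>i<n. cnj (v $ i) * (\<Sum>j<n. complex_of_real (A $$ (i,j)) * v $ j))"
    unfolding q_def sum_distrib_left[of z] by (intro sum.cong refl) (simp add: Cv mult.left_commute[of z])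
  also have "\<dots> = (\<Sum>i<n. \<Sum>j<n. complex_of_real (A $$ (i,j)) * (cnj (v $ i) * v $ j))"
    by (simp add: sum_distrib_left algebra_simps)
  \<comment> \<open>Exchanging the summations and using symmetry of \<open>A\<close> turns the form
    into its own complex conjugate.\<close>
  also have "\<dots> = (\<Sum>j<n. \<Sum>i<n. complex_of_real (A $$ (j,i)) * (cnj (v $ i) * v $ j))"
    by (subst sum.swap) (intro sum.cong refl, simp add: symA)
  also have "\<dots> = (\<Sum>j<n. v $ j * cnj (\<Sum>i<n. complex_of_real (A $$ (j,i)) * v $ i))"
    by (simp add: sum_distrib_left algebra_simps)
  also have "\<dots> = cnj z * q"
    unfolding q_def sum_distrib_left[of "cnj z"]
    by (intro sum.cong refl) (simp add: Cv mult.left_commute[of _ "cnj z"])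
  finally have "z * q = cnj z * q" .
  moreover have "q \<noteq> 0"
  proof -
    obtain i where "i < n" "v $ i \<noteq> 0" using v by (metis eq_vecI carrier_vecD index_zero_vec)
    then have "0 < (\<Sum>i<n. (cmod (v $ i))\<^sup>2)"
      by (intro sum_pos2[where i = i]) auto
    then show ?thesis unfolding q using of_real_eq_0_iff by force
  qed
  ultimately have "z = complex_of_real (Re z)" by (auto simp: complex_eq_iff)
  with root have "poly (map_poly complex_of_real (char_poly A)) (complex_of_real (Re z)) = 0"
    by (simp add: of_real_hom.char_poly_hom[OF A])
  then have "poly (char_poly A) (Re z) = 0" by simp
  then show ?thesis using eigenvalue_root_char_poly[OF A] by blast
qed

text \<open>The reflection in the hyperplane orthogonal to v - e_0 exchanges the two unit vectors v
  and e_0.\<close>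

lemma householder_exists:
  fixes v :: "real Matrix.vec"
  assumes v: "v \<in> carrier_vec n" and vv: "v \<bullet> v = 1" and n: "n > 0"
  shows "\<exists>H \<in> carrier_mat n n. transpose_mat H = H \<and> H * H = 1\<^sub>m n \<and> H *\<^sub>v unit_vec n 0 = v"
proof -
  define e :: "nat \<Rightarrow> real" where "e i = (if i = 0 then 1 else 0)" for i
  define w where "w i = v $ i - e i" for i
  define s where "s = (\<Sum>i<n. w i * w i)"
  \<comment> \<open>If v = e_0 then \<open>s\<close> is 0, division by zero gives
    \<open>c = 0\<close>, and \<open>H\<close> is the identity. The relation
    \<open>c * c * s = 2 * c\<close> below therefore covers both cases.\<close>
  define c where "c = 2 / s"
  define H where "H = Matrix.mat n n (\<lambda>(i,j). (if i = j then 1 else 0) - c * w i * w j)"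
  have s: "s = - 2 * w 0"
  proof -
    have "s = (\<Sum>i<n. v $ i * v $ i) - 2 * (\<Sum>i<n. e i * v $ i) + (\<Sum>i<n. e i * e i)"
      unfolding s_def w_def by (simp add: algebra_simps sum.distrib sum_subtractf sum_distrib_left)
    moreover have "(\<Sum>i<n. e i * v $ i) = v $ 0" "(\<Sum>i<n. e i * e i) = 1"
      unfolding e_def using n by (auto simp: if_distrib[where f="\<lambda>x. x * _"] sum.delta cong: if_cong)
    moreover have "(\<Sum>i<n. v $ i * v $ i) = 1"
      using vv v by (simp add: scalar_prod_def lessThan_atLeast0)
    ultimately show ?thesis unfolding w_def e_def by simp
  qed
  have cc: "c * c * s = 2 * c" unfolding c_def by simp
  have H: "H \<in> carrier_mat n n" unfolding H_def by simp
  moreover have "transpose_mat H = H" unfolding H_def by (auto simp: mult_ac)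
  moreover have "H * H = 1\<^sub>m n"
  proof (rule eq_matI)
    fix i j assume ij: "i < dim_row (1\<^sub>m n :: real mat)" "j < dim_col (1\<^sub>m n :: real mat)"
    have "(H * H) $$ (i,j) = (\<Sum>k<n. ((if i = k then 1 else 0) - c * w i * w k) *
        ((if k = j then 1 else 0) - c * w k * w j))"
      using ij unfolding H_def by (simp add: scalar_prod_def lessThan_atLeast0)
    also have "\<dots> = (\<Sum>k<n. (if k = i then (if i = j then 1 else 0) - c * w i * w j else 0)
        - (if k = j then c * w i * w j else 0) + c * c * w i * w j * (w k * w k))"
      by (intro sum.cong refl) (auto simp: algebra_simps)
    also have "\<dots> = (if i = j then 1 else 0) - c * w i * w j - c * w i * w j + c * c * w i * w j * s"
      using ij unfolding s_def by (simp add: sum.distrib sum_subtractf sum_distrib_left)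
    also have "\<dots> = (if i = j then 1 else 0) + (c * c * s - 2 * c) * (w i * w j)"
      by (simp add: algebra_simps)
    finally show "(H * H) $$ (i,j) = 1\<^sub>m n $$ (i,j)" using ij by (simp add: cc)
  qed (use H in auto)
  moreover have "H *\<^sub>v unit_vec n 0 = v"
  proof (rule eq_vecI)
    fix i assume i: "i < dim_vec v"
    have "(H *\<^sub>v unit_vec n 0) $ i = e i - c * w i * w 0"
      using i v n unfolding H_def e_def by (simp add: scalar_prod_right_unit)
    also have "\<dots> = v $ i"
    proof (cases "s = 0")
      case True
      then have "w i = 0" unfolding s_def using i v by (subst (asm) sum_nonneg_eq_0_iff) auto
      then show ?thesis unfolding w_def by simp
    next
      case False
      then have "c * w 0 = -1" unfolding c_def using s by (simp add: field_simps)
      then have "c * w i * w 0 = - w i" by (metis mult.assoc mult.commute mult_minus1)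
      then show ?thesis unfolding w_def by simp
    qed
    finally show "(H *\<^sub>v unit_vec n 0) $ i = v $ i" .
  qed (use H v in auto)
  ultimately show ?thesis by blast
qed

text \<open>Induction on the dimension by deflation: a Householder reflection moves a unit
  eigenvector to e_0, which splits off a one-dimensional block, and the induction hypothesis
  diagonalises the rest.\<close>

lemma real_spectral:
  fixes A :: "real Matrix.mat"
  assumes "A \<in> carrier_mat n n" and "transpose_mat A = A"
  shows "\<exists>P d. P \<in> carrier_mat n n \<and> transpose_mat P * P = 1\<^sub>m n \<and>
    A * P = P * Matrix.mat n n (\<lambda>(i,j). if i = j then d i else 0)"
  using assms
proof (induction n arbitrary: A)
  case 0
  then show ?case by (intro exI[of _ "1\<^sub>m 0"] exI[of _ "\<lambda>_. 0"]) (auto intro!: eq_matI)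
next
  case (Suc n)
  let ?n = "Suc n"
  note A = Suc.prems(1) and sym = Suc.prems(2)
  obtain a where "eigenvalue A a" using sym_eigenvalue_exists[OF A sym] by auto
  then obtain v0 where v0: "v0 \<in> carrier_vec ?n" "v0 \<noteq> 0\<^sub>v ?n" "A *\<^sub>v v0 = a \<cdot>\<^sub>v v0"
    using A unfolding eigenvalue_def eigenvector_def by auto
  define s where "s = v0 \<bullet> v0"
  have "s > 0"
  proof -
    obtain i where "i < ?n" "v0 $ i \<noteq> 0" using v0 by (metis eq_vecI carrier_vecD index_zero_vec)
    then show ?thesis unfolding s_def scalar_prod_def
      by (intro sum_pos2[where i = i]) (use v0 in auto)
  qed
  define v where "v = (1 / sqrt s) \<cdot>\<^sub>v v0"
  have v: "v \<in> carrier_vec ?n" "A *\<^sub>v v = a \<cdot>\<^sub>v v"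
    using v0 A unfolding v_def by (auto simp: mult_mat_vec smult_smult_assoc mult.commute)
  have "v \<bullet> v = 1"
    using v0 \<open>s > 0\<close> unfolding v_def by (simp add: s_def[symmetric])
  then obtain H where H: "H \<in> carrier_mat ?n ?n" "transpose_mat H = H" "H * H = 1\<^sub>m ?n"
      "H *\<^sub>v unit_vec ?n 0 = v"
    using householder_exists[OF v(1)] by auto
  \<comment> \<open>Since e_0 is an eigenvector of \<open>B\<close>, the first column of
    \<open>B\<close> is a multiple of e_0. Symmetry gives the same for the first row, hence the
    block form with \<open>A3\<close> below.\<close>
  define B where "B = H * A * H"
  have B: "B \<in> carrier_mat ?n ?n" unfolding B_def using H A by auto
  have symB: "transpose_mat B = B"
  proof -
    have "transpose_mat B = H * (A * H)"
      unfolding B_def using H(1,2) A sym by (simp add: transpose_mult[of _ ?n ?n _ ?n])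
    then show ?thesis
      unfolding B_def using H(1) A by (simp add: assoc_mult_mat[of _ ?n ?n _ ?n _ ?n])
  qed
  have "B *\<^sub>v unit_vec ?n 0 = H *\<^sub>v (A *\<^sub>v (H *\<^sub>v unit_vec ?n 0))"
    unfolding B_def using H A by (simp add: assoc_mult_mat_vec[of _ ?n ?n _ ?n])
  also have "\<dots> = a \<cdot>\<^sub>v (H *\<^sub>v (H *\<^sub>v unit_vec ?n 0))"
    using H v by (simp add: mult_mat_vec[of _ ?n ?n])
  also have "\<dots> = a \<cdot>\<^sub>v unit_vec ?n 0"
    using assoc_mult_mat_vec[OF H(1,1) unit_vec_carrier[of ?n 0]] H(3) by simp
  finally have Be: "B *\<^sub>v unit_vec ?n 0 = a \<cdot>\<^sub>v unit_vec ?n 0" .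
  have B0: "B $$ (i,0) = (if i = 0 then a else 0)" if "i < ?n" for i
    using arg_cong[OF Be, of "\<lambda>w. w $ i"] that B by (simp add: scalar_prod_right_unit)
  have B0': "B $$ (0,i) = (if i = 0 then a else 0)" if "i < ?n" for i
    using B0[OF that] arg_cong[OF symB, of "\<lambda>w. w $$ (i,0)"] that B by simp
  define A3 where "A3 = Matrix.mat n n (\<lambda>(i,j). B $$ (Suc i, Suc j))"
  have A3: "A3 \<in> carrier_mat n n" unfolding A3_def by simp
  have symA3: "transpose_mat A3 = A3"
  proof (rule eq_matI)
    fix i j assume "i < dim_row A3" "j < dim_col A3"
    then show "transpose_mat A3 $$ (i,j) = A3 $$ (i,j)"
      using arg_cong[OF symB, of "\<lambda>w. w $$ (Suc i,Suc j)"] B unfolding A3_def by simp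
  qed (auto simp: A3_def)
  obtain P d where P: "P \<in> carrier_mat n n" "transpose_mat P * P = 1\<^sub>m n"
      "A3 * P = P * Matrix.mat n n (\<lambda>(i,j). if i = j then d i else 0)" (is "_ = P * ?D")
    using Suc.IH[OF A3 symA3] by blast
  let ?a = "Matrix.mat 1 1 (\<lambda>_. a)"
  have Bfb: "B = four_block_mat ?a (0\<^sub>m 1 n) (0\<^sub>m n 1) A3"
    by (rule eq_matI) (use B in \<open>auto simp: B0 B0' A3_def less_Suc_eq_0_disj\<close>)
  define Q where "Q = four_block_mat (1\<^sub>m 1) (0\<^sub>m 1 n) (0\<^sub>m n 1) P"
  have Q: "Q \<in> carrier_mat ?n ?n"
    using four_block_carrier_mat[OF one_carrier_mat[of 1] P(1)] unfolding Q_def by simp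
  have QQ: "transpose_mat Q * Q = 1\<^sub>m ?n"
  proof -
    have QT: "transpose_mat Q = four_block_mat (1\<^sub>m 1) (0\<^sub>m 1 n) (0\<^sub>m n 1) (transpose_mat P)"
      unfolding Q_def using P(1) by (subst transpose_four_block_mat[of _ 1 1 _ n _ n]) auto
    have "transpose_mat Q * Q = four_block_mat (1\<^sub>m 1) (0\<^sub>m 1 n) (0\<^sub>m n 1) (transpose_mat P * P)"
      unfolding QT unfolding Q_def using P(1) by (subst mult_four_block_mat[of _ 1 1 _ n _ n _ _ 1 _ n]) auto
    also have "\<dots> = 1\<^sub>m ?n" unfolding P(2) by (rule eq_matI) auto
    finally show ?thesis .
  qed
  define d' where "d' i = (case i of 0 \<Rightarrow> a | Suc i \<Rightarrow> d i)" for i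
  let ?D' = "Matrix.mat ?n ?n (\<lambda>(i,j). if i = j then d' i else 0)"
  have D': "?D' = four_block_mat ?a (0\<^sub>m 1 n) (0\<^sub>m n 1) ?D"
    by (rule eq_matI) (auto simp: d'_def less_Suc_eq_0_disj)
  have BQ: "B * Q = Q * ?D'"
  proof -
    have "B * Q = four_block_mat ?a (0\<^sub>m 1 n) (0\<^sub>m n 1) (A3 * P)"
      unfolding Bfb Q_def using P(1) A3
      by (subst mult_four_block_mat[of _ 1 1 _ n _ n _ _ 1 _ n]) auto
    moreover have "Q * ?D' = four_block_mat ?a (0\<^sub>m 1 n) (0\<^sub>m n 1) (P * ?D)"
      unfolding D' Q_def using P(1)
      by (subst mult_four_block_mat[of _ 1 1 _ n _ n _ _ 1 _ n]) auto
    ultimately show ?thesis unfolding P(3) by simp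
  qed
  have HHM: "H * (H * M) = M" if "M \<in> carrier_mat ?n ?n" for M
    using assoc_mult_mat[OF H(1) H(1) that] H(3) that by simp
  have "transpose_mat (H * Q) * (H * Q) = transpose_mat Q * (H * (H * Q))"
    using H(1,2) Q assoc_mult_mat[of "transpose_mat Q" ?n ?n H ?n "H * Q" ?n]
    by (simp add: transpose_mult[of _ ?n ?n _ ?n])
  then have "transpose_mat (H * Q) * (H * Q) = 1\<^sub>m ?n" using HHM[OF Q] QQ by simp
  moreover have "A * (H * Q) = H * Q * ?D'"
  proof -
    have "H * (B * Q) = H * (H * (A * (H * Q)))"
      unfolding B_def using H(1) Q A by (simp add: assoc_mult_mat[of _ ?n ?n _ ?n _ ?n])
    then have "A * (H * Q) = H * (Q * ?D')" using HHM[of "A * (H * Q)"] H(1) Q A BQ by simp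
    then show ?thesis using H Q by (simp add: assoc_mult_mat[of _ ?n ?n _ ?n _ ?n])
  qed
  ultimately show ?case using H Q by (intro exI[of _ "H * Q"] exI[of _ d']) auto
qed

subsection \<open>Trace inequalities for the matrix exponential\<close>

text \<open>Completeness is expressed by Parseval's identity; together with the unit norms it forces
  orthogonality, since the expansion of |u_i|^2 already contains the term 1.\<close>

definition eigbasis :: "nat \<Rightarrow> real Matrix.mat \<Rightarrow> (nat \<Rightarrow> real) \<Rightarrow> (nat \<Rightarrow> real Matrix.vec) \<Rightarrow> bool" where
  "eigbasis r A a u \<longleftrightarrow>
    (\<forall>i<r. u i \<in> carrier_vec r \<and> A *\<^sub>v u i = a i \<cdot>\<^sub>v u i \<and> u i \<bullet> u i = 1) \<and>
    (\<forall>x \<in> carrier_vec r. \<forall>y \<in> carrier_vec r. x \<bullet> y = (\<Sum>i<r. (u i \<bullet> x) * (u i \<bullet> y)))"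

lemma sym_mat_scalar:
  fixes A :: "real Matrix.mat"
  assumes "A \<in> carrier_mat n n" "transpose_mat A = A" "x \<in> carrier_vec n" "y \<in> carrier_vec n"
  shows "(A *\<^sub>v x) \<bullet> y = x \<bullet> (A *\<^sub>v y)"
  using transpose_vec_mult_scalar[OF assms(1,4,3)] assms by simp

lemma eigbasis_exists:
  assumes A: "A \<in> carrier_mat r r" and sym: "transpose_mat A = A"
  shows "\<exists>a u. eigbasis r A a u"
proof -
  obtain P d where P: "P \<in> carrier_mat r r" "transpose_mat P * P = 1\<^sub>m r"
    and AP: "A * P = P * Matrix.mat r r (\<lambda>(i,j). if i = j then d i else 0)"
    using real_spectral[OF A sym] by blast
  \<comment> \<open>A left inverse of a square matrix is a right inverse; this second identity is
    Parseval's identity for the columns of \<open>P\<close>.\<close>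
  have PPT: "P * transpose_mat P = 1\<^sub>m r"
    using mat_mult_left_right_inverse[OF _ P(1) P(2)] P(1) by simp
  have "A *\<^sub>v col P i = d i \<cdot>\<^sub>v col P i" if i: "i < r" for i
  proof (rule eq_vecI)
    fix l assume "l < dim_vec (d i \<cdot>\<^sub>v col P i)"
    then have l: "l < r" using P by simp
    have "(A *\<^sub>v col P i) $ l = (A * P) $$ (l,i)" using l i A P by simp
    also have "\<dots> = (\<Sum>j<r. P $$ (l,j) * (if j = i then d j else 0))"
      unfolding AP using l i P by (simp add: scalar_prod_def lessThan_atLeast0)
    also have "\<dots> = (d i \<cdot>\<^sub>v col P i) $ l"
      using l i P by (simp add: if_distrib[where f="\<lambda>x. _ * x"] cong: if_cong)
    finally show "(A *\<^sub>v col P i) $ l = (d i \<cdot>\<^sub>v col P i) $ l" .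
  qed (use A P in auto)
  moreover have "col P i \<bullet> col P i = 1" if "i < r" for i
    using arg_cong[OF P(2), of "\<lambda>B. B $$ (i,i)"] that P(1) by simp
  moreover have "x \<bullet> y = (\<Sum>i<r. (col P i \<bullet> x) * (col P i \<bullet> y))"
    if xy: "x \<in> carrier_vec r" "y \<in> carrier_vec r" for x y
  proof -
    have "x \<bullet> y = x \<bullet> (P *\<^sub>v (transpose_mat P *\<^sub>v y))"
      using assoc_mult_mat_vec[of P r r "transpose_mat P" r y] P(1) PPT xy by simp
    also have "\<dots> = (transpose_mat P *\<^sub>v x) \<bullet> (transpose_mat P *\<^sub>v y)"
      using transpose_vec_mult_scalar[of P r r "transpose_mat P *\<^sub>v y" x] P(1) xy by simp
    finally show ?thesis
      using P(1) by (simp add: scalar_prod_def[of "transpose_mat P *\<^sub>v x"] lessThan_atLeast0)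
  qed
  moreover have "col P i \<in> carrier_vec r" for i using P(1) by auto
  ultimately have "eigbasis r A d (col P)" unfolding eigbasis_def by blast
  then show ?thesis by blast
qed

lemma eigbasisD:
  assumes "eigbasis r A a u" "i < r"
  shows "u i \<in> carrier_vec r" "A *\<^sub>v u i = a i \<cdot>\<^sub>v u i" "u i \<bullet> u i = 1"
  using assms unfolding eigbasis_def by blast+

lemma eigbasis_expand:
  assumes "eigbasis r A a u" "x \<in> carrier_vec r" "y \<in> carrier_vec r"
  shows "x \<bullet> y = (\<Sum>i<r. (u i \<bullet> x) * (u i \<bullet> y))"
  using assms unfolding eigbasis_def by blast+

lemma eigbasis_bilinear:
  assumes A: "A \<in> carrier_mat r r" "transpose_mat A = A" and e: "eigbasis r A a u"
    and x: "x \<in> carrier_vec r" and i: "i < r"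
  shows "u i \<bullet> (A *\<^sub>v x) = a i * (u i \<bullet> x)"
  using sym_mat_scalar[OF A eigbasisD(1)[OF e i] x] eigbasisD(1,2)[OF e i] x by simp

text \<open>The entry of A - B between an eigenvector of \<open>A\<close> and one of
  \<open>B\<close>. Through it, trace inequalities for two non-commuting matrices reduce to scalar
  inequalities for pairs of eigenvalues.\<close>

lemma eigbasis_diff:
  assumes A: "A \<in> carrier_mat r r" "transpose_mat A = A" and u: "eigbasis r A a u"
    and B: "B \<in> carrier_mat r r" and v: "eigbasis r B b v"
    and ij: "i < r" "j < r"
  shows "(a i - b j) * (u i \<bullet> v j) = u i \<bullet> (A *\<^sub>v v j) - u i \<bullet> (B *\<^sub>v v j)"
  using eigbasis_bilinear[OF A u eigbasisD(1)[OF v ij(2)] ij(1)] eigbasisD[OF v ij(2)] eigbasisD(1)[OF u ij(1)]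
  by (simp add: algebra_simps)

section \<open>Scalar inequalities behind the trace inequalities\<close>

text \<open>The left side is the integral of exp (-u) over [0, s], and the trapezoidal rule
  overestimates the integral of a convex function.\<close>

lemma trapezoid_exp:
  fixes s :: real
  assumes "s \<ge> 0"
  shows "1 - exp (-s) \<le> s * (1 + exp (-s)) / 2"
proof -
  let ?g = "\<lambda>s::real. s * (1 + exp (-s)) / 2 - 1 + exp (-s)"
  have "?g 0 \<le> ?g s"
  proof (rule DERIV_nonneg_imp_nondecreasing[OF assms])
    fix x :: real assume "0 \<le> x"
    have "(?g has_real_derivative (1 - exp (-x) * (1 + x)) / 2) (at x)"
      by (auto intro!: derivative_eq_intros simp: field_simps)
    moreover have "exp (-x) * (1 + x) \<le> exp (-x) * exp x"
      using exp_ge_add_one_self[of x] by (intro mult_left_mono) auto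
    then have "(1 - exp (-x) * (1 + x)) / 2 \<ge> 0" by (simp flip: exp_add)
    ultimately show "\<exists>y. (?g has_real_derivative y) (at x) \<and> 0 \<le> y" by blast
  qed
  then show ?thesis by simp
qed

text \<open>By the trapezoidal bound, a secant of exp (-\<theta> x) has slope at least -\<theta>
  times the mean of the two endpoint values. The hypothesis on \<open>c\<close> turns the difference
  of exponentials into this slope times \<open>t * p\<close>.\<close>

lemma exp_chord_bound:
  fixes a b \<theta> c p t :: real
  assumes "\<theta> \<ge> 0" "t \<ge> 0" "(a - b) * c = - t * p"
  shows "p * c * (exp (-\<theta> * b) - exp (-\<theta> * a)) \<ge> - t * \<theta> / 2 * p\<^sup>2 * (exp (-\<theta> * a) + exp (-\<theta> * b))"
proof (cases "a = b")
  case True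
  then show ?thesis using assms by (simp add: mult_nonneg_nonneg)
next
  case False
  have chord: "exp (-\<theta> * x) - exp (-\<theta> * y) \<le> \<theta> * (y - x) / 2 * (exp (-\<theta> * x) + exp (-\<theta> * y))"
    if "x \<le> y" for x y :: real
  proof -
    have "exp (-\<theta> * x) * (1 - exp (- (\<theta> * (y - x))))
        \<le> exp (-\<theta> * x) * (\<theta> * (y - x) * (1 + exp (- (\<theta> * (y - x)))) / 2)"
      using trapezoid_exp[of "\<theta> * (y - x)"] assms that by (intro mult_left_mono) auto
    moreover have "exp (-\<theta> * x) * exp (- (\<theta> * (y - x))) = exp (-\<theta> * y)"
      by (simp add: algebra_simps flip: exp_add)
    ultimately show ?thesis by (simp add: algebra_simps)
  qed
  define k where "k = (exp (-\<theta> * b) - exp (-\<theta> * a)) / (b - a)"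
  have "- (\<theta> / 2 * (exp (-\<theta> * a) + exp (-\<theta> * b))) \<le> k"
    using False chord[of a b] chord[of b a] unfolding k_def
    by (cases "a < b") (auto simp: field_simps)
  then have "t * p\<^sup>2 * (- (\<theta> / 2 * (exp (-\<theta> * a) + exp (-\<theta> * b)))) \<le> t * p\<^sup>2 * k"
    using assms by (intro mult_left_mono) auto
  also have "t * p\<^sup>2 * k = p * c * (exp (-\<theta> * b) - exp (-\<theta> * a))"
  proof -
    have "t * p = (b - a) * c" using assms(3) by (simp add: algebra_simps)
    then have "t * p\<^sup>2 * k = p * c * ((b - a) * k)" by (simp add: power2_eq_square mult_ac)
    then show ?thesis unfolding k_def using False by simp
  qed
  finally show ?thesis by (simp add: algebra_simps add_divide_distrib)
qed

text \<open>In the next three lemmas \<open>a\<close>, \<open>b\<close> play the role of the spectra of two symmetric matrices and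
  \<open>c i j\<close> that of the inner products of their eigenvectors.\<close>

lemma klein_rank_one:
  fixes a b x y :: "nat \<Rightarrow> real" and c :: "nat \<Rightarrow> nat \<Rightarrow> real"
  assumes E: "\<And>i j. i < r \<Longrightarrow> j < r \<Longrightarrow> (a i - b j) * c i j = - t * (x i * y j)"
    and c1: "\<And>j. j < r \<Longrightarrow> (\<Sum>i<r. (c i j)\<^sup>2) = 1" and c2: "\<And>i. i < r \<Longrightarrow> (\<Sum>j<r. (c i j)\<^sup>2) = 1"
    and xc: "\<And>j. j < r \<Longrightarrow> (\<Sum>i<r. c i j * x i) = y j"
  shows "(\<Sum>i<r. exp (-\<theta> * a i)) \<ge> (\<Sum>j<r. exp (-\<theta> * b j)) + t * \<theta> * (\<Sum>j<r. exp (-\<theta> * b j) * (y j)\<^sup>2)"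
proof -
  have pw: "exp (-\<theta> * a i) * (c i j)\<^sup>2 \<ge> exp (-\<theta> * b j) * (c i j)\<^sup>2 + t * \<theta> * (exp (-\<theta> * b j) * y j * (c i j * x i))"
    if ij: "i < r" "j < r" for i j
  proof -
    \<comment> \<open>Convexity: the tangent of exp (-\<theta> x) at \<open>b j\<close>, evaluated
      at \<open>a i\<close>, lies below the function. This is Klein's inequality before
      summation.\<close>
    have "exp (-\<theta> * b j) * (1 - \<theta> * (a i - b j)) \<le> exp (-\<theta> * b j) * exp (- \<theta> * (a i - b j))"
      using exp_ge_add_one_self[of "- \<theta> * (a i - b j)"] by (intro mult_left_mono) auto
    also have "\<dots> = exp (-\<theta> * a i)" by (simp add: algebra_simps flip: exp_add)
    finally have "exp (-\<theta> * b j) * (1 - \<theta> * (a i - b j)) * (c i j)\<^sup>2 \<le> exp (-\<theta> * a i) * (c i j)\<^sup>2"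
      by (intro mult_right_mono) auto
    moreover have "exp (-\<theta> * b j) * (1 - \<theta> * (a i - b j)) * (c i j)\<^sup>2
        = exp (-\<theta> * b j) * (c i j)\<^sup>2 - \<theta> * exp (-\<theta> * b j) * c i j * ((a i - b j) * c i j)"
      by (simp add: algebra_simps power2_eq_square)
    ultimately show ?thesis unfolding E[OF ij] by (simp add: algebra_simps)
  qed
  \<comment> \<open>The weights \<open>(c i j)\<^sup>2\<close> are doubly stochastic, so both traces
    can be written as double sums over the same pairs of eigenvectors.\<close>
  have "(\<Sum>i<r. exp (-\<theta> * a i)) = (\<Sum>i<r. \<Sum>j<r. exp (-\<theta> * a i) * (c i j)\<^sup>2)"
    by (intro sum.cong refl) (simp add: c2 flip: sum_distrib_left)
  also have "\<dots> = (\<Sum>j<r. \<Sum>i<r. exp (-\<theta> * a i) * (c i j)\<^sup>2)" by (rule sum.swap)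
  also have "\<dots> \<ge> (\<Sum>j<r. \<Sum>i<r. exp (-\<theta> * b j) * (c i j)\<^sup>2 + t * \<theta> * (exp (-\<theta> * b j) * y j * (c i j * x i)))"
    by (intro sum_mono) (use pw in auto)
  moreover have "(\<Sum>j<r. \<Sum>i<r. exp (-\<theta> * b j) * (c i j)\<^sup>2 + t * \<theta> * (exp (-\<theta> * b j) * y j * (c i j * x i)))
    = (\<Sum>j<r. exp (-\<theta> * b j) + t * \<theta> * (exp (-\<theta> * b j) * y j * y j))"
    by (intro sum.cong refl) (simp add: sum.distrib c1 xc flip: sum_distrib_left)
  ultimately show ?thesis by (simp add: sum.distrib sum_distrib_left power2_eq_square mult_ac)
qed

lemma quadratic_decay_rank_one:
  fixes a b x y :: "nat \<Rightarrow> real" and c :: "nat \<Rightarrow> nat \<Rightarrow> real"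
  assumes E: "\<And>i j. i < r \<Longrightarrow> j < r \<Longrightarrow> (a i - b j) * c i j = - t * (x i * y j)"
    and xc: "\<And>j. j < r \<Longrightarrow> (\<Sum>i<r. c i j * x i) = y j"
    and yc: "\<And>i. i < r \<Longrightarrow> (\<Sum>j<r. c i j * y j) = x i"
    and nx: "(\<Sum>i<r. (x i)\<^sup>2) \<le> M" and ny: "(\<Sum>j<r. (y j)\<^sup>2) \<le> M"
    and t: "t \<ge> 0" and \<theta>: "\<theta> \<ge> 0"
  shows "(\<Sum>j<r. exp (-\<theta> * b j) * (y j)\<^sup>2) * (1 + t * \<theta> * M / 2) \<ge> (\<Sum>i<r. exp (-\<theta> * a i) * (x i)\<^sup>2) * (1 - t * \<theta> * M / 2)"
proof -
  let ?hA = "\<Sum>i<r. exp (-\<theta> * a i) * (x i)\<^sup>2" and ?hB = "\<Sum>j<r. exp (-\<theta> * b j) * (y j)\<^sup>2"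
  \<comment> \<open>Both quadratic forms are expanded in the mixed basis, so that their difference
    contains only differences of exponentials at \<open>a i\<close> and \<open>b j\<close>.\<close>
  have d1: "?hB - ?hA = (\<Sum>i<r. \<Sum>j<r. x i * y j * c i j * (exp (-\<theta> * b j) - exp (-\<theta> * a i)))"
  proof -
    have "(\<Sum>i<r. \<Sum>j<r. x i * y j * c i j * exp (-\<theta> * b j)) = (\<Sum>j<r. \<Sum>i<r. x i * y j * c i j * exp (-\<theta> * b j))"
      by (rule sum.swap)
    also have "\<dots> = (\<Sum>j<r. exp (-\<theta> * b j) * y j * (\<Sum>i<r. c i j * x i))"
      by (simp add: sum_distrib_left mult_ac)
    also have "\<dots> = ?hB" by (intro sum.cong refl) (simp add: xc power2_eq_square)
    finally have 1: "(\<Sum>i<r. \<Sum>j<r. x i * y j * c i j * exp (-\<theta> * b j)) = ?hB" .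
    have "(\<Sum>i<r. \<Sum>j<r. x i * y j * c i j * exp (-\<theta> * a i)) = (\<Sum>i<r. exp (-\<theta> * a i) * x i * (\<Sum>j<r. c i j * y j))"
      by (simp add: sum_distrib_left mult_ac)
    also have "\<dots> = ?hA" by (intro sum.cong refl) (simp add: yc power2_eq_square)
    finally show ?thesis using 1 by (simp add: right_diff_distrib sum_subtractf)
  qed
  \<comment> \<open>\<open>exp_chord_bound\<close> is applied with p = \<open>x i * y j\<close>. Its
    right side contains p squared, which makes the double sums factor into products in
    \<open>d4\<close>.\<close>
  have d2: "(\<Sum>i<r. \<Sum>j<r. x i * y j * c i j * (exp (-\<theta> * b j) - exp (-\<theta> * a i)))
     \<ge> (\<Sum>i<r. \<Sum>j<r. - t * \<theta> / 2 * (x i * y j)\<^sup>2 * (exp (-\<theta> * a i) + exp (-\<theta> * b j)))"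
    by (intro sum_mono exp_chord_bound) (use E t \<theta> in auto)
  have d3: "(\<Sum>i<r. \<Sum>j<r. - t * \<theta> / 2 * (x i * y j)\<^sup>2 * (exp (-\<theta> * a i) + exp (-\<theta> * b j)))
     = - t * \<theta> / 2 * (\<Sum>i<r. \<Sum>j<r. (exp (-\<theta> * a i) * (x i)\<^sup>2) * (y j)\<^sup>2 + (x i)\<^sup>2 * (exp (-\<theta> * b j) * (y j)\<^sup>2))"
    unfolding sum_distrib_left by (intro sum.cong refl) (simp add: algebra_simps power_mult_distrib)
  have d4: "(\<Sum>i<r. \<Sum>j<r. (exp (-\<theta> * a i) * (x i)\<^sup>2) * (y j)\<^sup>2 + (x i)\<^sup>2 * (exp (-\<theta> * b j) * (y j)\<^sup>2))
     = ?hA * (\<Sum>j<r. (y j)\<^sup>2) + (\<Sum>i<r. (x i)\<^sup>2) * ?hB"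
    by (simp add: sum.distrib sum_product)
  have "?hA * (\<Sum>j<r. (y j)\<^sup>2) + (\<Sum>i<r. (x i)\<^sup>2) * ?hB \<le> ?hA * M + M * ?hB"
    using nx ny by (intro add_mono mult_left_mono mult_right_mono sum_nonneg) auto
  then have d5: "- t * \<theta> / 2 * (?hA * M + M * ?hB) \<le> - t * \<theta> / 2 * (?hA * (\<Sum>j<r. (y j)\<^sup>2) + (\<Sum>i<r. (x i)\<^sup>2) * ?hB)"
    using t \<theta> by (intro mult_left_mono_neg) auto
  have "- t * \<theta> / 2 * (?hA * M + M * ?hB) \<le> ?hB - ?hA"
    by (rule order_trans[OF d5]) (use d2 in \<open>simp only: d1 d3 d4\<close>)
  then show ?thesis by (simp add: algebra_simps)
qed

lemma exp_trace_monotone: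
  fixes a b x y x' y' :: "nat \<Rightarrow> real" and c :: "nat \<Rightarrow> nat \<Rightarrow> real"
  assumes E: "\<And>i j. i < r \<Longrightarrow> j < r \<Longrightarrow> (a i - b j) * c i j = x i * x' j - y i * y' j"
    and xc: "\<And>j. j < r \<Longrightarrow> (\<Sum>i<r. c i j * x i) = x' j" "\<And>i. i < r \<Longrightarrow> (\<Sum>j<r. c i j * x' j) = x i"
    and yc: "\<And>j. j < r \<Longrightarrow> (\<Sum>i<r. c i j * y i) = y' j" "\<And>i. i < r \<Longrightarrow> (\<Sum>j<r. c i j * y' j) = y i"
    and \<theta>: "\<theta> \<ge> 0"
  shows "(\<Sum>i<r. exp (-\<theta> * a i) * (x i)\<^sup>2) - (\<Sum>i<r. exp (-\<theta> * a i) * (y i)\<^sup>2)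
    \<le> (\<Sum>j<r. exp (-\<theta> * b j) * (x' j)\<^sup>2) - (\<Sum>j<r. exp (-\<theta> * b j) * (y' j)\<^sup>2)"
proof -
  let ?f = "\<lambda>s. exp (-\<theta> * s)"
  have pw: "(?f (a i) - ?f (b j)) * c i j * (x i * x' j - y i * y' j) \<le> 0" if ij: "i < r" "j < r" for i j
  proof -
    \<comment> \<open>The function exp (-\<theta> x) is decreasing, so the two differences have
      opposite signs. Multiplying by \<open>(c i j)\<^sup>2\<close> lets \<open>E\<close> replace
      the eigenvalue difference.\<close>
    have "(?f (a i) - ?f (b j)) * (a i - b j) \<le> 0"
    proof (cases "a i \<le> b j")
      case True
      then have "?f (b j) \<le> ?f (a i)" using \<theta> by (simp add: mult_left_mono)
      with True show ?thesis by (simp add: mult_nonneg_nonpos)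
    next
      case False
      then have "?f (a i) \<le> ?f (b j)" using \<theta> by (simp add: mult_left_mono)
      with False show ?thesis by (simp add: mult_nonpos_nonneg)
    qed
    then have "(?f (a i) - ?f (b j)) * (a i - b j) * (c i j)\<^sup>2 \<le> 0" by (rule mult_nonpos_nonneg) simp
    then show ?thesis unfolding E[OF ij, symmetric] by (simp only: power2_eq_square mult_ac)
  qed
  have "(\<Sum>i<r. \<Sum>j<r. (?f (a i) - ?f (b j)) * c i j * (x i * x' j - y i * y' j)) \<le> 0"
    by (intro sum_nonpos) (use pw in auto)
  moreover have "(\<Sum>i<r. \<Sum>j<r. ?f (a i) * c i j * (x i * x' j - y i * y' j))
      = (\<Sum>i<r. ?f (a i) * (x i * (\<Sum>j<r. c i j * x' j) - y i * (\<Sum>j<r. c i j * y' j)))"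
    by (simp add: sum_distrib_left sum_subtractf right_diff_distrib mult_ac)
  moreover have "(\<Sum>i<r. \<Sum>j<r. ?f (b j) * c i j * (x i * x' j - y i * y' j))
      = (\<Sum>j<r. ?f (b j) * (x' j * (\<Sum>i<r. c i j * x i) - y' j * (\<Sum>i<r. c i j * y i)))"
    by (subst sum.swap) (simp add: sum_distrib_left sum_subtractf right_diff_distrib mult_ac)
  ultimately show ?thesis
    by (simp add: xc yc left_diff_distrib sum_subtractf right_diff_distrib power2_eq_square)
qed

section \<open>Trace and quadratic form of the matrix exponential under rank-one updates\<close>

text \<open>Choosing one spectral decomposition for each matrix makes \<open>trexp\<close> and
  \<open>qexp\<close> functions of the matrix alone.\<close>

definition eigsys :: "nat \<Rightarrow> real Matrix.mat \<Rightarrow> (nat \<Rightarrow> real) \<times> (nat \<Rightarrow> real Matrix.vec)" where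
  "eigsys r A = (SOME p. eigbasis r A (fst p) (snd p))"

text \<open>For symmetric \<open>A\<close> these are the trace of \<open>exp (-\<theta>A)\<close> and the value at \<open>x\<close> of its quadratic form.\<close>

definition trexp :: "real \<Rightarrow> nat \<Rightarrow> real Matrix.mat \<Rightarrow> real" where
  "trexp \<theta> r A = (\<Sum>i<r. exp (-\<theta> * fst (eigsys r A) i))"

definition qexp :: "real \<Rightarrow> nat \<Rightarrow> real Matrix.mat \<Rightarrow> real Matrix.vec \<Rightarrow> real" where
  "qexp \<theta> r A x = (\<Sum>i<r. exp (-\<theta> * fst (eigsys r A) i) * (snd (eigsys r A) i \<bullet> x)\<^sup>2)"

lemma eigsys:
  assumes "A \<in> carrier_mat r r" "transpose_mat A = A"
  shows "eigbasis r A (fst (eigsys r A)) (snd (eigsys r A))"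
proof -
  obtain a u where "eigbasis r A a u" using eigbasis_exists[OF assms] by blast
  then have "eigbasis r A (fst (a,u)) (snd (a,u))" by simp
  then show ?thesis unfolding eigsys_def by (rule someI)
qed

lemma trexp_nonneg: "trexp \<theta> r A \<ge> 0"
  unfolding trexp_def by (intro sum_nonneg) auto

text \<open>Provides the hypotheses of the scalar lemmas for c_ij = u_i . v_j: change of basis in
  both directions, and double stochasticity of the squares.\<close>

lemma eigbasis_cross:
  assumes u: "eigbasis r A a u" and v: "eigbasis r B b v" and x: "x \<in> carrier_vec r"
  shows "j < r \<Longrightarrow> (\<Sum>i<r. (u i \<bullet> v j) * (u i \<bullet> x)) = v j \<bullet> x"
    and "i < r \<Longrightarrow> (\<Sum>j<r. (u i \<bullet> v j) * (v j \<bullet> x)) = u i \<bullet> x"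
    and "j < r \<Longrightarrow> (\<Sum>i<r. (u i \<bullet> v j)\<^sup>2) = 1"
    and "i < r \<Longrightarrow> (\<Sum>j<r. (u i \<bullet> v j)\<^sup>2) = 1"
proof -
  have comm: "v j \<bullet> u i = u i \<bullet> v j" if "i < r" "j < r" for i j
    using eigbasisD(1)[OF u that(1)] eigbasisD(1)[OF v that(2)] by (rule comm_scalar_prod[rotated])
  show "(\<Sum>i<r. (u i \<bullet> v j) * (u i \<bullet> x)) = v j \<bullet> x" if "j < r"
    using eigbasis_expand[OF u eigbasisD(1)[OF v that] x] by (rule sym)
  show "(\<Sum>j<r. (u i \<bullet> v j) * (v j \<bullet> x)) = u i \<bullet> x" if i: "i < r"
  proof -
    have "(\<Sum>j<r. (u i \<bullet> v j) * (v j \<bullet> x)) = (\<Sum>j<r. (v j \<bullet> u i) * (v j \<bullet> x))"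
      by (intro sum.cong refl) (simp add: comm i)
    then show ?thesis using eigbasis_expand[OF v eigbasisD(1)[OF u i] x] by (simp only:)
  qed
  show "(\<Sum>i<r. (u i \<bullet> v j)\<^sup>2) = 1" if "j < r"
    using eigbasis_expand[OF u eigbasisD(1)[OF v that] eigbasisD(1)[OF v that]] eigbasisD(3)[OF v that]
    by (simp only: power2_eq_square)
  show "(\<Sum>j<r. (u i \<bullet> v j)\<^sup>2) = 1" if i: "i < r"
  proof -
    have "(\<Sum>j<r. (u i \<bullet> v j)\<^sup>2) = (\<Sum>j<r. (v j \<bullet> u i) * (v j \<bullet> u i))"
      by (intro sum.cong refl) (simp add: comm i power2_eq_square)
    then show ?thesis
      using eigbasis_expand[OF v eigbasisD(1)[OF u i] eigbasisD(1)[OF u i]] eigbasisD(3)[OF u i] by (simp only:)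
  qed
qed

lemma eigbasis_norm:
  assumes u: "eigbasis r A a u" and x: "x \<in> carrier_vec r"
  shows "(\<Sum>i<r. (u i \<bullet> x)\<^sup>2) = x \<bullet> x"
  using eigbasis_expand[OF u x x] by (simp only: power2_eq_square)

text \<open>Matrix form of the scalar lemmas for B = A + t x x^T. The first part bounds the drop of
  the trace by the quadratic form at the new matrix; the second limits how much this form can decay,
  which allows iteration.\<close>

lemma rank_one_step:
  assumes A: "A \<in> carrier_mat r r" "transpose_mat A = A" and B: "B \<in> carrier_mat r r" "transpose_mat B = B"
    and x: "x \<in> carrier_vec r"
    and AB: "\<And>z w. z \<in> carrier_vec r \<Longrightarrow> w \<in> carrier_vec r \<Longrightarrow>
      z \<bullet> (B *\<^sub>v w) = z \<bullet> (A *\<^sub>v w) + t * ((z \<bullet> x) * (x \<bullet> w))"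
  shows "trexp \<theta> r A \<ge> trexp \<theta> r B + t * \<theta> * qexp \<theta> r B x"
    and "t \<ge> 0 \<Longrightarrow> \<theta> \<ge> 0 \<Longrightarrow> x \<bullet> x \<le> M \<Longrightarrow>
      qexp \<theta> r B x * (1 + t * \<theta> * M / 2) \<ge> qexp \<theta> r A x * (1 - t * \<theta> * M / 2)"
proof -
  define a u b v where "a = fst (eigsys r A)" and "u = snd (eigsys r A)"
    and "b = fst (eigsys r B)" and "v = snd (eigsys r B)"
  note d = this
  have u: "eigbasis r A a u" and v: "eigbasis r B b v" using eigsys[OF A] eigsys[OF B] unfolding d by auto
  have E: "(a i - b j) * (u i \<bullet> v j) = - t * ((u i \<bullet> x) * (v j \<bullet> x))" if ij: "i < r" "j < r" for i j
    using eigbasis_diff[OF A u B(1) v ij] AB[OF eigbasisD(1)[OF u ij(1)] eigbasisD(1)[OF v ij(2)]]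
      comm_scalar_prod[OF x eigbasisD(1)[OF v ij(2)]] by simp
  note cr = eigbasis_cross[OF u v x]
  show "trexp \<theta> r A \<ge> trexp \<theta> r B + t * \<theta> * qexp \<theta> r B x"
    unfolding trexp_def qexp_def d[symmetric]
    by (rule klein_rank_one[of r a b "\<lambda>i j. u i \<bullet> v j" t "\<lambda>i. u i \<bullet> x" "\<lambda>j. v j \<bullet> x", OF E cr(3) cr(4) cr(1)])
  show "qexp \<theta> r B x * (1 + t * \<theta> * M / 2) \<ge> qexp \<theta> r A x * (1 - t * \<theta> * M / 2)"
    if "t \<ge> 0" "\<theta> \<ge> 0" "x \<bullet> x \<le> M"
    unfolding qexp_def d[symmetric]
    by (rule quadratic_decay_rank_one[of r a b "\<lambda>i j. u i \<bullet> v j" t "\<lambda>i. u i \<bullet> x" "\<lambda>j. v j \<bullet> x", OF E cr(1) cr(2)])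
      (use that eigbasis_norm[OF u x] eigbasis_norm[OF v x] in \<open>simp_all only:\<close>)
qed

text \<open>Here B = A - x x^T + y y^T. The inequality is tr ((A - B) (exp (-\<theta>A) - exp
  (-\<theta>B))) \<le> 0 written through quadratic forms.\<close>

lemma qexp_swap:
  assumes A: "A \<in> carrier_mat r r" "transpose_mat A = A" and B: "B \<in> carrier_mat r r" "transpose_mat B = B"
    and x: "x \<in> carrier_vec r" and y: "y \<in> carrier_vec r"
    and AB: "\<And>z w. z \<in> carrier_vec r \<Longrightarrow> w \<in> carrier_vec r \<Longrightarrow>
      z \<bullet> (A *\<^sub>v w) + (z \<bullet> y) * (y \<bullet> w) = z \<bullet> (B *\<^sub>v w) + (z \<bullet> x) * (x \<bullet> w)"
    and \<theta>: "\<theta> \<ge> 0"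
  shows "qexp \<theta> r A x - qexp \<theta> r A y \<le> qexp \<theta> r B x - qexp \<theta> r B y"
proof -
  define a u b v where "a = fst (eigsys r A)" and "u = snd (eigsys r A)"
    and "b = fst (eigsys r B)" and "v = snd (eigsys r B)"
  note d = this
  have u: "eigbasis r A a u" and v: "eigbasis r B b v" using eigsys[OF A] eigsys[OF B] unfolding d by auto
  have E: "(a i - b j) * (u i \<bullet> v j) = (u i \<bullet> x) * (v j \<bullet> x) - (u i \<bullet> y) * (v j \<bullet> y)" if ij: "i < r" "j < r" for i j
    using eigbasis_diff[OF A u B(1) v ij] AB[OF eigbasisD(1)[OF u ij(1)] eigbasisD(1)[OF v ij(2)]]
      comm_scalar_prod[OF x eigbasisD(1)[OF v ij(2)]] comm_scalar_prod[OF y eigbasisD(1)[OF v ij(2)]] by simp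
  note cx = eigbasis_cross[OF u v x] and cy = eigbasis_cross[OF u v y]
  show ?thesis unfolding qexp_def d[symmetric]
    by (rule exp_trace_monotone[of r a b "\<lambda>i j. u i \<bullet> v j", OF E cx(1) cx(2) cy(1) cy(2) \<theta>])
qed

definition rank_one_update :: "real Matrix.mat \<Rightarrow> real \<Rightarrow> real Matrix.vec \<Rightarrow> real Matrix.mat" where
  "rank_one_update A t x = Matrix.mat (dim_row A) (dim_col A) (\<lambda>(l,m). A $$ (l,m) + t * (x $ l * x $ m))"

lemma rank_one_update:
  assumes A: "A \<in> carrier_mat r r" "transpose_mat A = A" and x: "x \<in> carrier_vec r"
  shows "rank_one_update A t x \<in> carrier_mat r r"
    and "transpose_mat (rank_one_update A t x) = rank_one_update A t x"
    and "z \<in> carrier_vec r \<Longrightarrow> w \<in> carrier_vec r \<Longrightarrow>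
      z \<bullet> (rank_one_update A t x *\<^sub>v w) = z \<bullet> (A *\<^sub>v w) + t * ((z \<bullet> x) * (x \<bullet> w))"
proof -
  show c: "rank_one_update A t x \<in> carrier_mat r r" unfolding rank_one_update_def using A by auto
  have symA: "A $$ (i,j) = A $$ (j,i)" if "i < r" "j < r" for i j
    using arg_cong[OF A(2), of "\<lambda>B. B $$ (j,i)"] that A(1) by auto
  show "transpose_mat (rank_one_update A t x) = rank_one_update A t x"
    unfolding rank_one_update_def using A(1) symA by (intro eq_matI) (auto simp: mult_ac)
  assume z: "z \<in> carrier_vec r" and w: "w \<in> carrier_vec r"
  have "z \<bullet> (rank_one_update A t x *\<^sub>v w)
      = (\<Sum>l<r. z $ l * (\<Sum>m<r. (A $$ (l,m) + t * (x $ l * x $ m)) * w $ m))"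
    unfolding rank_one_update_def using A(1) z w by (simp add: scalar_prod_def lessThan_atLeast0)
  also have "\<dots> = (\<Sum>l<r. z $ l * (\<Sum>m<r. A $$ (l,m) * w $ m)) + t * ((\<Sum>l<r. z $ l * x $ l) * (\<Sum>m<r. x $ m * w $ m))"
    by (simp add: sum_product sum_distrib_left sum.distrib algebra_simps)
  also have "\<dots> = z \<bullet> (A *\<^sub>v w) + t * ((z \<bullet> x) * (x \<bullet> w))"
    using A(1) z w x by (simp add: scalar_prod_def lessThan_atLeast0)
  finally show "z \<bullet> (rank_one_update A t x *\<^sub>v w) = z \<bullet> (A *\<^sub>v w) + t * ((z \<bullet> x) * (x \<bullet> w))" .
qed

text \<open>The update by x x^T is made in \<open>N\<close> steps of size 1/N. Summing the drops of
  the trace, each bounded below through the decay of the quadratic form, gives a geometric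
  series.\<close>

lemma rank_one_iterate:
  assumes A: "A \<in> carrier_mat r r" "transpose_mat A = A" and x: "x \<in> carrier_vec r" and M: "x \<bullet> x \<le> M" "M > 0"
    and \<theta>: "\<theta> > 0" and N: "real N > \<theta> * M"
  shows "trexp \<theta> r (rank_one_update A 1 x) \<le> trexp \<theta> r A -
    (1 - \<theta> * M / (2 * N)) / M * (1 - ((1 - \<theta> * M / (2 * N)) / (1 + \<theta> * M / (2 * N))) ^ N) * qexp \<theta> r A x"
proof -
  have N0: "real N > 0" using N M \<theta> by (meson le_less_trans less_imp_le mult_nonneg_nonneg)
  define \<epsilon> where "\<epsilon> = \<theta> * M / (2 * N)"
  have \<epsilon>: "0 < \<epsilon>" "\<epsilon> < 1" unfolding \<epsilon>_def using N N0 M \<theta> by (auto simp: field_simps)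
  \<comment> \<open>The fraction of the quadratic form that is guaranteed to survive one step, by
    the second part of \<open>rank_one_step\<close> with t = 1/N.\<close>
  define q where "q = (1 - \<epsilon>) / (1 + \<epsilon>)"
  have q: "0 \<le> q" "1 - q = 2 * \<epsilon> / (1 + \<epsilon>)" unfolding q_def using \<epsilon> by (auto simp: field_simps)
  define S where "S s = rank_one_update A (real s / N) x" for s :: nat
  have S: "S s \<in> carrier_mat r r" "transpose_mat (S s) = S s" for s
    unfolding S_def using rank_one_update[OF A x] by auto
  have SS: "z \<bullet> (S (Suc s) *\<^sub>v w) = z \<bullet> (S s *\<^sub>v w) + (1 / N) * ((z \<bullet> x) * (x \<bullet> w))"
    if "z \<in> carrier_vec r" "w \<in> carrier_vec r" for s z w
    unfolding S_def rank_one_update(3)[OF A x that] by (simp add: add_divide_distrib distrib_right)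
  have tr: "trexp \<theta> r (S s) \<ge> trexp \<theta> r (S (Suc s)) + \<theta> / N * qexp \<theta> r (S (Suc s)) x" for s
    using rank_one_step(1)[OF S S x SS] by simp
  have h: "qexp \<theta> r (S (Suc s)) x \<ge> q * qexp \<theta> r (S s) x" for s
    using rank_one_step(2)[OF S S x SS _ _ M(1), of \<theta> s] \<theta> \<epsilon> unfolding q_def \<epsilon>_def
    by (simp add: field_simps)
  have A0: "S 0 = A" unfolding S_def rank_one_update_def using A by (intro eq_matI) auto
  have hq: "qexp \<theta> r (S s) x \<ge> q ^ s * qexp \<theta> r A x" for s
  proof (induction s)
    case (Suc s)
    have "q ^ Suc s * qexp \<theta> r A x = q * (q ^ s * qexp \<theta> r A x)" by simp
    also have "\<dots> \<le> q * qexp \<theta> r (S s) x" using Suc q by (intro mult_left_mono) auto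
    also note h[of s]
    finally show ?case .
  qed (simp add: A0)
  have sum: "trexp \<theta> r (S s) \<le> trexp \<theta> r A - \<theta> / N * (\<Sum>k<s. q ^ Suc k) * qexp \<theta> r A x" for s
  proof (induction s)
    case (Suc s)
    have "\<theta> / N * (q ^ Suc s * qexp \<theta> r A x) \<le> \<theta> / N * qexp \<theta> r (S (Suc s)) x"
      using hq[of "Suc s"] \<theta> by (intro mult_left_mono) auto
    then show ?case using tr[of s] Suc by (simp add: algebra_simps)
  qed (simp add: A0)
  have "\<theta> / N * (\<Sum>k<N. q ^ Suc k) = \<theta> / N * (q * ((1 - q ^ N) / (1 - q)))"
  proof -
    have "1 - q > 0" unfolding q(2) using \<epsilon> by simp
    then show ?thesis by (simp add: sum_gp_strict flip: sum_distrib_left)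
  qed
  \<comment> \<open>Here \<theta>/N = 2\<epsilon>/M and q/(1 - q) = (1 - \<epsilon>)/(2\<epsilon>),
    so the step size cancels from the geometric sum.\<close>
  also have "\<dots> = (1 - \<epsilon>) / M * (1 - q ^ N)"
  proof -
    have "\<theta> / N = 2 * \<epsilon> / M" unfolding \<epsilon>_def using M by simp
    moreover have "q / (1 - q) = (1 - \<epsilon>) / (2 * \<epsilon>)" 
      unfolding q(2) unfolding q_def using \<epsilon> by (simp add: divide_divide_eq_left divide_divide_eq_right)
    then have "q * ((1 - q ^ N) / (1 - q)) = (1 - \<epsilon>) / (2 * \<epsilon>) * (1 - q ^ N)" by (metis times_divide_eq_left times_divide_eq_right)
    ultimately show ?thesis using \<epsilon> by simp
  qed
  finally have "trexp \<theta> r (S N) \<le> trexp \<theta> r A - (1 - \<epsilon>) / M * (1 - q ^ N) * qexp \<theta> r A x"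
    using sum[of N] by simp
  then show ?thesis unfolding q_def \<epsilon>_def using N0 by (simp add: S_def)
qed

text \<open>The limit of \<open>rank_one_iterate\<close> as \<open>N\<close> tends to infinity,
  where q^N tends to exp (-\<theta>M). Golden-Thompson would give the same bound with |x|^2 in place
  of \<open>M\<close>; the constant is decreasing in that argument.\<close>

lemma trexp_rank_one_update:
  assumes A: "A \<in> carrier_mat r r" "transpose_mat A = A" and x: "x \<in> carrier_vec r" and M: "x \<bullet> x \<le> M" "M > 0"
    and \<theta>: "\<theta> > 0"
  shows "trexp \<theta> r (rank_one_update A 1 x) \<le> trexp \<theta> r A - (1 - exp (-\<theta> * M)) / M * qexp \<theta> r A x"
proof -
  define T where "T = \<theta> * M"
  have T: "T > 0" unfolding T_def using \<theta> M by simp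
  have lim: "(\<lambda>N::nat. (1 - T / (2 * N)) * (1 - ((1 - T / (2 * N)) / (1 + T / (2 * N))) ^ N)) \<longlonglongrightarrow> 1 - exp (- T)"
    using T by real_asymp
  have "(\<lambda>N::nat. trexp \<theta> r A - ((1 - T / (2 * N)) * (1 - ((1 - T / (2 * N)) / (1 + T / (2 * N))) ^ N)) / M * qexp \<theta> r A x)
     \<longlonglongrightarrow> trexp \<theta> r A - (1 - exp (- T)) / M * qexp \<theta> r A x"
    using M by (intro tendsto_intros lim) auto
  moreover have "\<forall>\<^sub>F N in sequentially. trexp \<theta> r (rank_one_update A 1 x)
     \<le> trexp \<theta> r A - ((1 - T / (2 * N)) * (1 - ((1 - T / (2 * N)) / (1 + T / (2 * N))) ^ N)) / M * qexp \<theta> r A x"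
    using eventually_gt_at_top[of "nat \<lceil>T\<rceil>"]
  proof eventually_elim
    case (elim N)
    then have "real N > \<theta> * M" unfolding T_def by linarith
    from rank_one_iterate[OF A x M \<theta> this] show ?case unfolding T_def by simp
  qed
  ultimately have "trexp \<theta> r (rank_one_update A 1 x) \<le> trexp \<theta> r A - (1 - exp (- T)) / M * qexp \<theta> r A x"
    by (intro tendsto_lowerbound) auto
  then show ?thesis unfolding T_def by simp
qed

subsection \<open>Matrix Chernoff bound for sampling without replacement\<close>

definition gram :: "nat \<Rightarrow> (nat \<Rightarrow> real Matrix.vec) \<Rightarrow> nat set \<Rightarrow> real Matrix.mat" where
  "gram r X J = Matrix.mat r r (\<lambda>(l,m). \<Sum>j\<in>J. X j $ l * X j $ m)"

lemma gram_carrier: "gram r X J \<in> carrier_mat r r"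
  and gram_sym: "transpose_mat (gram r X J) = gram r X J"
  unfolding gram_def by (auto simp: mult.commute)

lemma gram_insert:
  assumes "finite J" "j \<notin> J"
  shows "gram r X (insert j J) = rank_one_update (gram r X J) 1 (X j)"
  unfolding gram_def rank_one_update_def using assms by (intro eq_matI) auto

lemma gram_bilinear:
  assumes "finite J" "\<And>j. j \<in> J \<Longrightarrow> X j \<in> carrier_vec r" "z \<in> carrier_vec r" "w \<in> carrier_vec r"
  shows "z \<bullet> (gram r X J *\<^sub>v w) = (\<Sum>j\<in>J. (z \<bullet> X j) * (X j \<bullet> w))"
  using assms(1,2)
proof (induction J)
  case empty
  have "gram r X {} *\<^sub>v w = 0\<^sub>v r"
    unfolding gram_def using assms(4) by (intro eq_vecI) (auto simp: scalar_prod_def)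
  then show ?case using assms(3) by simp
next
  case (insert j J)
  then show ?case
    using rank_one_update(3)[OF gram_carrier gram_sym, of "X j" r z w X J 1] assms(3,4) by (simp add: gram_insert)
qed

section \<open>Double counting over subsets of fixed size\<close>

text \<open>Pairs (J, x) with x outside J correspond to pairs (K, x) with x in K through K = J + x,
  and each K of size k + 1 occurs k + 1 times.\<close>

lemma sum_subsets_Suc:
  fixes \<phi> :: "nat set \<Rightarrow> real"
  assumes "finite A"
  shows "(\<Sum>J | J \<subseteq> A \<and> card J = k. \<Sum>x\<in>A - J. \<phi> (insert x J)) = Suc k * (\<Sum>K | K \<subseteq> A \<and> card K = Suc k. \<phi> K)"
proof -
  let ?F = "\<lambda>k. {J. J \<subseteq> A \<and> card J = k}"
  have fin: "finite (?F k)" for k using assms by simp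
  have finJ: "finite J" if "J \<in> ?F k" for J k using that assms finite_subset by blast
  have "(\<Sum>J\<in>?F k. \<Sum>x\<in>A - J. \<phi> (insert x J)) = (\<Sum>(J,x)\<in>Sigma (?F k) (\<lambda>J. A - J). \<phi> (insert x J))"
    using assms fin by (subst sum.Sigma) auto
  also have "\<dots> = (\<Sum>(K,x)\<in>Sigma (?F (Suc k)) (\<lambda>K. K). \<phi> K)"
  proof (rule sum.reindex_bij_witness[where j = "\<lambda>(J,x). (insert x J, x)" and i = "\<lambda>(K,x). (K - {x}, x)"])
    fix p assume "p \<in> Sigma (?F k) (\<lambda>J. A - J)"
    then obtain J x where p: "p = (J,x)" "J \<in> ?F k" "x \<in> A" "x \<notin> J" by auto
    show "(case case p of (J,x) \<Rightarrow> (insert x J, x) of (K,x) \<Rightarrow> (K - {x}, x)) = p" using p by simp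
    show "(case p of (J,x) \<Rightarrow> (insert x J, x)) \<in> Sigma (?F (Suc k)) (\<lambda>K. K)"
      using p finJ[OF p(2)] by auto
    show "(case case p of (J,x) \<Rightarrow> (insert x J, x) of (K,x) \<Rightarrow> \<phi> K) = (case p of (J,x) \<Rightarrow> \<phi> (insert x J))"
      using p by simp
  next
    fix p assume "p \<in> Sigma (?F (Suc k)) (\<lambda>K. K)"
    then obtain K x where p: "p = (K,x)" "K \<in> ?F (Suc k)" "x \<in> K" by auto
    show "(case case p of (K,x) \<Rightarrow> (K - {x}, x) of (J,x) \<Rightarrow> (insert x J, x)) = p" using p by (simp add: insert_absorb)
    show "(case p of (K,x) \<Rightarrow> (K - {x}, x)) \<in> Sigma (?F k) (\<lambda>J. A - J)"
      using p finJ[OF p(2)] by auto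
  qed
  also have "\<dots> = (\<Sum>K\<in>?F (Suc k). \<Sum>x\<in>K. \<phi> K)"
  proof -
    have "\<forall>K\<in>?F (Suc k). finite K" using finJ by blast
    from sum.Sigma[OF fin this, of "\<lambda>K x. \<phi> K"] show ?thesis by simp
  qed
  also have "\<dots> = Suc k * (\<Sum>K\<in>?F (Suc k). \<phi> K)"
    unfolding sum_distrib_left by (intro sum.cong refl) auto
  finally show ?thesis .
qed

lemma sum_swap_nonpos:
  fixes h :: "nat set \<Rightarrow> nat \<Rightarrow> real"
  assumes "finite A"
    and h: "\<And>J x y. J \<subseteq> A \<Longrightarrow> x \<in> J \<Longrightarrow> y \<in> A - J \<Longrightarrow>
      h J x - h J y \<le> h (insert y (J - {x})) x - h (insert y (J - {x})) y"
  shows "(card A - k) * (\<Sum>J | J \<subseteq> A \<and> card J = k. \<Sum>x\<in>J. h J x) \<le> k * (\<Sum>J | J \<subseteq> A \<and> card J = k. \<Sum>y\<in>A - J. h J y)"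
proof -
  let ?F = "{J. J \<subseteq> A \<and> card J = k}"
  let ?T = "Sigma ?F (\<lambda>J. J \<times> (A - J))"
  let ?g = "\<lambda>(J,x,y). h J x - h J y"
  \<comment> \<open>The exchange of x and y. The last two components are swapped as well, so that a
    second application restores the triple.\<close>
  let ?s = "\<lambda>(J,x,y). (insert y (J - {x}), y, x)"
  have fin: "finite ?F" using assms by simp
  have finJ: "finite J" if "J \<in> ?F" for J using that assms finite_subset by blast
  have inv: "?s p \<in> ?T \<and> ?s (?s p) = p \<and> ?g p + ?g (?s p) \<le> 0" if p: "p \<in> ?T" for p
  proof -
    obtain J x y where p: "p = (J,x,y)" "J \<in> ?F" "x \<in> J" "y \<in> A" "y \<notin> J" using p by auto
    have "card (insert y (J - {x})) = Suc (card (J - {x}))"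
      using p(5) finJ[OF p(2)] by (intro card_insert_disjoint) auto
    also have "\<dots> = card J" using finJ[OF p(2)] p(3) by (rule card.remove[symmetric])
    also have "\<dots> = k" using p(2) by simp
    finally have "card (insert y (J - {x})) = k" .
    moreover have "insert x (insert y (J - {x}) - {y}) = J" "x \<noteq> y" using p by auto
    moreover have "x \<in> A" using p by auto
    ultimately show ?thesis using p h[of J x y] by auto
  qed
  note inv1 = inv[THEN conjunct1] and inv2 = inv[THEN conjunct2, THEN conjunct1]
    and inv3 = inv[THEN conjunct2, THEN conjunct2]
  \<comment> \<open>Reindexing by the involution shows that twice the sum is a sum of pairs
    \<open>?g p + ?g (?s p)\<close>, each nonpositive by the hypothesis on \<open>h\<close>.\<close>
  have "(\<Sum>p\<in>?T. ?g p) = (\<Sum>p\<in>?T. ?g (?s p))"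
    by (rule sum.reindex_bij_witness[where i = ?s and j = ?s])
      (assumption | erule inv1 inv2 | simp only: inv2)+
  then have "2 * (\<Sum>p\<in>?T. ?g p) = (\<Sum>p\<in>?T. ?g p + ?g (?s p))" by (simp add: sum.distrib)
  also have "\<dots> \<le> 0" by (intro sum_nonpos inv3)
  finally have "(\<Sum>p\<in>?T. ?g p) \<le> 0" by simp
  \<comment> \<open>For fixed J each inner element meets \<open>card A - k\<close> outer ones, and
    each outer element meets \<open>k\<close> inner ones.\<close>
  moreover have "(\<Sum>p\<in>?T. ?g p) = (\<Sum>J\<in>?F. (card A - k) * (\<Sum>x\<in>J. h J x) - k * (\<Sum>y\<in>A - J. h J y))"
  proof -
    have "(\<Sum>p\<in>?T. ?g p) = (\<Sum>J\<in>?F. \<Sum>(x,y)\<in>J \<times> (A - J). h J x - h J y)"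
    proof -
      have "\<forall>J\<in>?F. finite (J \<times> (A - J))" using finJ assms(1) by blast
      from sum.Sigma[OF fin this, of "\<lambda>J (x,y). h J x - h J y"] show ?thesis by simp
    qed
    also have "\<dots> = (\<Sum>J\<in>?F. (card A - k) * (\<Sum>x\<in>J. h J x) - k * (\<Sum>y\<in>A - J. h J y))"
    proof (intro sum.cong refl)
      fix J assume J: "J \<in> ?F"
      then have "card (A - J) = card A - k" using finJ[OF J] by (auto simp: card_Diff_subset)
      moreover have "(\<Sum>(x,y)\<in>J \<times> (A - J). h J x - h J y) = (\<Sum>x\<in>J. \<Sum>y\<in>A - J. h J x - h J y)"
        using finJ[OF J] assms(1) by (subst sum.cartesian_product) auto
      ultimately show "(\<Sum>(x,y)\<in>J \<times> (A - J). h J x - h J y) = (card A - k) * (\<Sum>x\<in>J. h J x) - k * (\<Sum>y\<in>A - J. h J y)"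
        using J by (simp add: sum_subtractf sum_distrib_left)
    qed
    finally show ?thesis .
  qed
  ultimately show ?thesis by (simp add: sum_subtractf sum_distrib_left)
qed

section \<open>The exponential potential of a random subset of a Parseval frame\<close>

locale parseval_frame =
  fixes r n :: nat and X :: "nat \<Rightarrow> real Matrix.vec" and M :: real
  assumes X: "\<And>j. j < n \<Longrightarrow> X j \<in> carrier_vec r"
    and norm_le: "\<And>j. j < n \<Longrightarrow> X j \<bullet> X j \<le> M" and M_pos: "M > 0"
    and parseval: "\<And>z w. z \<in> carrier_vec r \<Longrightarrow> w \<in> carrier_vec r \<Longrightarrow> (\<Sum>j<n. (z \<bullet> X j) * (X j \<bullet> w)) = z \<bullet> w"
begin

lemma gram_frame_bilinear:
  assumes "J \<subseteq> {..<n}" "z \<in> carrier_vec r" "w \<in> carrier_vec r"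
  shows "z \<bullet> (gram r X J *\<^sub>v w) = (\<Sum>j\<in>J. (z \<bullet> X j) * (X j \<bullet> w))"
  using assms X finite_subset[OF assms(1)] by (intro gram_bilinear) auto

text \<open>Parseval's identity says that the x_j x_j^T sum to the identity, so the quadratic forms
  sum to the trace.\<close>

lemma sum_qexp: "(\<Sum>j<n. qexp \<theta> r (gram r X J) (X j)) = trexp \<theta> r (gram r X J)"
proof -
  define a u where "a = fst (eigsys r (gram r X J))" and "u = snd (eigsys r (gram r X J))"
  have u: "eigbasis r (gram r X J) a u"
    unfolding a_def u_def by (rule eigsys[OF gram_carrier gram_sym])
  have "(\<Sum>j<n. (u i \<bullet> X j)\<^sup>2) = 1" if i: "i < r" for i
  proof -
    have "(\<Sum>j<n. (u i \<bullet> X j)\<^sup>2) = (\<Sum>j<n. (u i \<bullet> X j) * (X j \<bullet> u i))"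
      using comm_scalar_prod[OF eigbasisD(1)[OF u i] X] by (intro sum.cong refl) (simp add: power2_eq_square)
    then show ?thesis
      using parseval[OF eigbasisD(1)[OF u i] eigbasisD(1)[OF u i]] eigbasisD(3)[OF u i] by (simp only:)
  qed
  then show ?thesis unfolding qexp_def trexp_def a_def[symmetric] u_def[symmetric]
    by (subst sum.swap) (simp flip: sum_distrib_left)
qed

lemma qexp_gram_swap:
  assumes J: "J \<subseteq> {..<n}" and x: "x \<in> J" and y: "y < n" "y \<notin> J" and \<theta>: "\<theta> \<ge> 0"
  defines "J' \<equiv> insert y (J - {x})"
  shows "qexp \<theta> r (gram r X J) (X x) - qexp \<theta> r (gram r X J) (X y)
    \<le> qexp \<theta> r (gram r X J') (X x) - qexp \<theta> r (gram r X J') (X y)"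
proof (rule qexp_swap[OF gram_carrier gram_sym gram_carrier gram_sym _ _ _ \<theta>])
  have finJ: "finite J" using J finite_subset by blast
  have xn: "x < n" using J x by auto
  show "X x \<in> carrier_vec r" "X y \<in> carrier_vec r" using X xn y by auto
  fix z w :: "real Matrix.vec" assume z: "z \<in> carrier_vec r" and w: "w \<in> carrier_vec r"
  have J': "J' \<subseteq> {..<n}" unfolding J'_def using J y by auto
  have "(\<Sum>j\<in>J'. (z \<bullet> X j) * (X j \<bullet> w)) = (z \<bullet> X y) * (X y \<bullet> w) + (\<Sum>j\<in>J - {x}. (z \<bullet> X j) * (X j \<bullet> w))"
    unfolding J'_def using finJ y by simp
  moreover have "(\<Sum>j\<in>J. (z \<bullet> X j) * (X j \<bullet> w)) = (z \<bullet> X x) * (X x \<bullet> w) + (\<Sum>j\<in>J - {x}. (z \<bullet> X j) * (X j \<bullet> w))"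
    using finJ x by (rule sum.remove)
  ultimately show "z \<bullet> (gram r X J *\<^sub>v w) + (z \<bullet> X y) * (X y \<bullet> w) = z \<bullet> (gram r X J' *\<^sub>v w) + (z \<bullet> X x) * (X x \<bullet> w)"
    using gram_frame_bilinear[OF J z w] gram_frame_bilinear[OF J' z w] by simp
qed

text \<open>Dividing by \<open>n choose k\<close> gives the mean potential of a uniformly chosen
  k-subset; the unnormalised sum suits the double counting.\<close>

definition total_trexp :: "real \<Rightarrow> nat \<Rightarrow> real" where
  "total_trexp \<theta> k = (\<Sum>J | J \<subseteq> {..<n} \<and> card J = k. trexp \<theta> r (gram r X J))"

lemma total_trexp_Suc:
  assumes \<theta>: "\<theta> > 0" and k: "k < n"
  shows "Suc k * total_trexp \<theta> (Suc k) \<le> (n - k) * ((1 - (1 - exp (-\<theta> * M)) / M / n) * total_trexp \<theta> k)"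
proof -
  let ?F = "{J. J \<subseteq> {..<n} \<and> card J = k}"
  let ?h = "\<lambda>J x. qexp \<theta> r (gram r X J) (X x)" and ?\<phi> = "\<lambda>J. trexp \<theta> r (gram r X J)"
  define c where "c = (1 - exp (-\<theta> * M)) / M"
  have c: "c \<ge> 0" unfolding c_def using \<theta> M_pos by simp
  have finJ: "finite J" if "J \<in> ?F" for J using that finite_subset by blast
  have step: "?\<phi> (insert x J) \<le> ?\<phi> J - c * ?h J x" if "J \<in> ?F" "x \<in> {..<n} - J" for J x
    using trexp_rank_one_update[of "gram r X J" r "X x" M \<theta>, OF gram_carrier gram_sym X norm_le M_pos \<theta>] that finJ[OF that(1)]
    by (simp add: gram_insert c_def)
  define Tin where "Tin = (\<Sum>J\<in>?F. \<Sum>x\<in>J. ?h J x)"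
  define Tout where "Tout = (\<Sum>J\<in>?F. \<Sum>x\<in>{..<n} - J. ?h J x)"
  have "Tin + Tout = total_trexp \<theta> k"
    unfolding Tin_def Tout_def total_trexp_def sum.distrib[symmetric]
  proof (intro sum.cong refl)
    fix J assume "J \<in> ?F"
    then show "(\<Sum>x\<in>J. ?h J x) + (\<Sum>x\<in>{..<n} - J. ?h J x) = ?\<phi> J"
      using sum.subset_diff[of J "{..<n}" "?h J"] sum_qexp[of \<theta> J] by simp
  qed
  moreover have "(n - k) * Tin \<le> k * Tout"
    using sum_swap_nonpos[of "{..<n}" ?h k] qexp_gram_swap \<theta> unfolding Tin_def Tout_def by simp
  \<comment> \<open>Eliminating \<open>Tin\<close> shows that the outer elements carry at least the
    fraction (n - k)/n of the total.\<close>
  ultimately have "(n - k) * (total_trexp \<theta> k - Tout) \<le> k * Tout"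
    by (metis add_diff_cancel_right')
  then have "(n - k) * total_trexp \<theta> k \<le> n * Tout"
    using k by (simp add: algebra_simps of_nat_diff)
  then have Tout: "(real n - k) * total_trexp \<theta> k / n \<le> Tout" using k by (simp add: field_simps of_nat_diff)
  have "Suc k * total_trexp \<theta> (Suc k) = (\<Sum>J\<in>?F. \<Sum>x\<in>{..<n} - J. ?\<phi> (insert x J))"
    unfolding total_trexp_def by (rule sum_subsets_Suc[symmetric]) simp
  also have "\<dots> \<le> (\<Sum>J\<in>?F. \<Sum>x\<in>{..<n} - J. ?\<phi> J - c * ?h J x)"
    by (intro sum_mono) (use step in auto)
  also have "\<dots> = (\<Sum>J\<in>?F. (real n - k) * ?\<phi> J) - c * Tout"
  proof -
    have "(\<Sum>x\<in>{..<n} - J. ?\<phi> J - c * ?h J x) = (real n - k) * ?\<phi> J - c * (\<Sum>x\<in>{..<n} - J. ?h J x)" if "J \<in> ?F" for J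
      using that finJ[OF that] k by (auto simp: sum_subtractf sum_distrib_left card_Diff_subset of_nat_diff)
    then have "(\<Sum>J\<in>?F. \<Sum>x\<in>{..<n} - J. ?\<phi> J - c * ?h J x)
        = (\<Sum>J\<in>?F. (real n - k) * ?\<phi> J - c * (\<Sum>x\<in>{..<n} - J. ?h J x))"
      by (rule sum.cong[OF refl])
    then show ?thesis unfolding Tout_def by (simp only: sum_subtractf sum_distrib_left)
  qed
  also have "\<dots> \<le> (real n - k) * total_trexp \<theta> k - c * ((real n - k) * total_trexp \<theta> k / n)"
    using mult_left_mono[OF Tout c] unfolding total_trexp_def by (simp add: sum_distrib_left)
  also have "\<dots> = (n - k) * ((1 - c / n) * total_trexp \<theta> k)"
    using k by (simp add: algebra_simps of_nat_diff)
  finally show ?thesis unfolding c_def .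
qed

lemma trexp_empty: "trexp \<theta> r (gram r X {}) = r"
proof -
  define a u where "a = fst (eigsys r (gram r X {}))" and "u = snd (eigsys r (gram r X {}))"
  have u: "eigbasis r (gram r X {}) a u"
    unfolding a_def u_def by (rule eigsys[OF gram_carrier gram_sym])
  have "a i = 0" if i: "i < r" for i
    using eigbasis_bilinear[OF gram_carrier gram_sym u eigbasisD(1)[OF u i] i] eigbasisD(3)[OF u i]
      gram_frame_bilinear[of "{}" "u i" "u i"] eigbasisD(1)[OF u i] by simp
  then show ?thesis unfolding trexp_def a_def[symmetric] by simp
qed

lemma total_trexp_bound:
  assumes \<theta>: "\<theta> > 0" and k: "k \<le> n"
  shows "total_trexp \<theta> k \<le> (n choose k) * (r * exp (- (k * (1 - exp (-\<theta> * M)) / (M * n))))"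
  using k
proof (induction k)
  case 0
  have "{J. J \<subseteq> {..<n} \<and> card J = 0} = {{}}" using finite_subset[OF _ finite_lessThan[of n]] by (auto simp: card_eq_0_iff)
  then show ?case unfolding total_trexp_def by (simp add: trexp_empty)
next
  case (Suc k)
  define c where "c = (1 - exp (-\<theta> * M)) / (M * n)"
  have nonneg: "total_trexp \<theta> k \<ge> 0" unfolding total_trexp_def by (intro sum_nonneg) (simp add: trexp_nonneg)
  have "1 - c \<le> exp (-c)" using exp_ge_add_one_self[of "-c"] by simp
  then have "(1 - c) * total_trexp \<theta> k \<le> exp (-c) * total_trexp \<theta> k" using nonneg by (intro mult_right_mono) auto
  also have "\<dots> \<le> exp (-c) * ((n choose k) * (r * exp (- (k * c))))"
    using Suc unfolding c_def by (intro mult_left_mono) auto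
  also have "\<dots> = (n choose k) * (r * exp (- (Suc k * c)))" by (simp add: algebra_simps flip: exp_add)
  finally have 1: "(1 - c) * total_trexp \<theta> k \<le> (n choose k) * (r * exp (- (Suc k * c)))" .
  have "Suc k * total_trexp \<theta> (Suc k) \<le> (n - k) * ((1 - c) * total_trexp \<theta> k)"
    using total_trexp_Suc[OF \<theta>, of k] Suc(2) unfolding c_def by simp
  also have "\<dots> \<le> (n - k) * ((n choose k) * (r * exp (- (Suc k * c))))" using 1 by (intro mult_left_mono) auto
  also have "\<dots> = real ((n - k) * (n choose k)) * (r * exp (- (Suc k * c)))" by simp
  \<comment> \<open>This absorption identity accounts for the normalisation: the mean itself shrinks
    by the factor 1 - c, which is at most exp (-c).\<close>
  also have "(n - k) * (n choose k) = Suc k * (n choose Suc k)"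
    using binomial_absorb_comp[of n k] binomial_absorption[of k n] by simp
  finally have "real (Suc k) * total_trexp \<theta> (Suc k) \<le> real (Suc k) * ((n choose Suc k) * (r * exp (- (Suc k * c))))"
    by (simp only: of_nat_mult mult.assoc)
  then have "total_trexp \<theta> (Suc k) \<le> (n choose Suc k) * (r * exp (- (Suc k * c)))"
    by (rule mult_left_le_imp_le) simp
  then show ?case unfolding c_def by simp
qed

text \<open>A Rayleigh quotient below \<open>s\<close> forces some eigenvalue of the Gram matrix
  below \<open>s\<close>, and the corresponding term alone bounds the trace from below.\<close>

lemma trexp_ge_of_small_form:
  assumes J: "J \<subseteq> {..<n}" and y: "y \<in> carrier_vec r" and small: "(\<Sum>j\<in>J. (X j \<bullet> y)\<^sup>2) < s * (y \<bullet> y)" and \<theta>: "\<theta> \<ge> 0"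
  shows "trexp \<theta> r (gram r X J) \<ge> exp (-\<theta> * s)"
proof -
  define a u where "a = fst (eigsys r (gram r X J))" and "u = snd (eigsys r (gram r X J))"
  have u: "eigbasis r (gram r X J) a u"
    unfolding a_def u_def by (rule eigsys[OF gram_carrier gram_sym])
  have "y \<bullet> (gram r X J *\<^sub>v y) = (\<Sum>i<r. (u i \<bullet> y) * (u i \<bullet> (gram r X J *\<^sub>v y)))"
    by (rule eigbasis_expand[OF u y mult_mat_vec_carrier[OF gram_carrier y]])
  also have "\<dots> = (\<Sum>i<r. a i * (u i \<bullet> y)\<^sup>2)"
    by (intro sum.cong refl) (simp add: eigbasis_bilinear[OF gram_carrier gram_sym u y] power2_eq_square)
  finally have "(\<Sum>i<r. a i * (u i \<bullet> y)\<^sup>2) = (\<Sum>j\<in>J. (y \<bullet> X j) * (X j \<bullet> y))"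
    using gram_frame_bilinear[OF J y y] by simp
  also have "\<dots> = (\<Sum>j\<in>J. (X j \<bullet> y)\<^sup>2)"
    using J comm_scalar_prod[OF y X] by (intro sum.cong refl) (auto simp: power2_eq_square)
  finally have lt: "(\<Sum>i<r. a i * (u i \<bullet> y)\<^sup>2) < (\<Sum>i<r. s * (u i \<bullet> y)\<^sup>2)"
    using small eigbasis_norm[OF u y] by (simp flip: sum_distrib_left)
  obtain i where i: "i < r" "a i < s"
  proof (rule ccontr)
    assume "\<not> thesis"
    then have "\<forall>i<r. s \<le> a i" using that by force
    then have "(\<Sum>i<r. s * (u i \<bullet> y)\<^sup>2) \<le> (\<Sum>i<r. a i * (u i \<bullet> y)\<^sup>2)"
      by (intro sum_mono mult_right_mono) auto
    with lt show False by simp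
  qed
  have "exp (-\<theta> * s) \<le> exp (-\<theta> * a i)" using i \<theta> by (simp add: mult_left_mono)
  also have "\<dots> \<le> (\<Sum>i<r. exp (-\<theta> * a i))" using i by (intro member_le_sum) auto
  finally show ?thesis unfolding trexp_def a_def .
qed

text \<open>Markov's inequality for the potential: every bad set has potential at least exp
  (-\<theta>s), while the sum over all k-subsets is bounded by
  \<open>total_trexp_bound\<close>.\<close>

theorem matrix_chernoff_lower:
  assumes k: "k \<le> n" and n: "n > 0" and \<delta>: "0 < \<delta>" "\<delta> < 1"
  shows "measure_pmf.prob (pmf_of_set {J. J \<subseteq> {..<n} \<and> card J = k})
      {J. \<exists>y \<in> carrier_vec r. (\<Sum>j\<in>J. (X j \<bullet> y)\<^sup>2) < (1 - \<delta>) * k / n * (y \<bullet> y)}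
    \<le> r * exp (- (k / (n * M) * (\<delta> + (1 - \<delta>) * ln (1 - \<delta>))))"
proof -
  let ?F = "{J. J \<subseteq> {..<n} \<and> card J = k}"
  let ?B = "{J. \<exists>y \<in> carrier_vec r. (\<Sum>j\<in>J. (X j \<bullet> y)\<^sup>2) < (1 - \<delta>) * k / n * (y \<bullet> y)}"
  define s where "s = (1 - \<delta>) * k / n"
  \<comment> \<open>The minimiser of the exponent -k (1 - exp (-\<theta>M)) / (M n) + \<theta>s. It
    is positive because \<delta> > 0, and it turns 1 - exp (-\<theta>M) into \<delta>.\<close>
  define \<theta> where "\<theta> = - ln (1 - \<delta>) / M"
  have \<theta>: "\<theta> > 0" unfolding \<theta>_def using \<delta> M_pos by (intro divide_pos_pos) (auto simp: ln_less_zero)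
  have \<theta>M: "exp (-\<theta> * M) = 1 - \<delta>" unfolding \<theta>_def using \<delta> M_pos by simp
  have fin: "finite ?F" by simp
  have cardF: "card ?F = n choose k" using n_subsets[of "{..<n}" k] by simp
  have pos: "real (n choose k) > 0" using k by simp
  have ne: "?F \<noteq> {}" using cardF pos by (metis card.empty less_irrefl of_nat_0)
  have "card (?F \<inter> ?B) * exp (-\<theta> * s) = (\<Sum>J\<in>?F \<inter> ?B. exp (-\<theta> * s))" by simp
  also have "\<dots> \<le> (\<Sum>J\<in>?F \<inter> ?B. trexp \<theta> r (gram r X J))"
  proof (intro sum_mono)
    fix J assume J: "J \<in> ?F \<inter> ?B"
    then obtain y where "y \<in> carrier_vec r" "(\<Sum>j\<in>J. (X j \<bullet> y)\<^sup>2) < s * (y \<bullet> y)" unfolding s_def by auto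
    then show "exp (-\<theta> * s) \<le> trexp \<theta> r (gram r X J)"
      using J \<theta> by (intro trexp_ge_of_small_form) auto
  qed
  also have "\<dots> \<le> total_trexp \<theta> k"
    unfolding total_trexp_def using fin by (intro sum_mono2) (auto simp: trexp_nonneg)
  also note total_trexp_bound[OF \<theta> k]
  finally have le: "card (?F \<inter> ?B) * exp (-\<theta> * s) \<le> (n choose k) * (r * exp (- (k * \<delta> / (M * n))))"
    unfolding \<theta>M by simp
  have "measure_pmf.prob (pmf_of_set ?F) ?B = card (?F \<inter> ?B) / (n choose k)"
    using measure_pmf_of_set[OF ne fin] cardF by simp
  also have "\<dots> = card (?F \<inter> ?B) * exp (-\<theta> * s) / (n choose k) * exp (\<theta> * s)"
    by (simp add: exp_minus field_simps)
  also have "\<dots> \<le> r * exp (- (k * \<delta> / (M * n))) * exp (\<theta> * s)"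
    using le pos by (intro mult_right_mono) (auto simp: divide_le_eq mult_ac)
  also have "\<dots> = r * exp (- (k * \<delta> / (M * n)) + \<theta> * s)" by (simp only: exp_add mult.assoc)
  also have "- (k * \<delta> / (M * n)) + \<theta> * s = - (k / (n * M) * (\<delta> + (1 - \<delta>) * ln (1 - \<delta>)))"
    unfolding \<theta>_def s_def using M_pos n by (simp add: field_simps)
  finally show ?thesis .
qed

end

subsection \<open>Pseudoinverse and singular values\<close>

lemma vnorm2_scalar_prod: "vnorm2 v = sqrt (v \<bullet> v)"
  unfolding vnorm2_def scalar_prod_def by (simp add: power2_eq_square lessThan_atLeast0)

lemma scalar_prod_self_nonneg: "(v :: real Matrix.vec) \<bullet> v \<ge> 0"
  unfolding scalar_prod_def by (intro sum_nonneg) auto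

lemma vnorm2_nonneg: "vnorm2 v \<ge> 0"
  unfolding vnorm2_scalar_prod using scalar_prod_self_nonneg by simp

lemma vnorm2_leI: "v \<bullet> v \<le> w \<bullet> w \<Longrightarrow> vnorm2 v \<le> vnorm2 w"
  unfolding vnorm2_scalar_prod by simp

lemma vnorm2_smult: "vnorm2 (c \<cdot>\<^sub>v v) = \<bar>c\<bar> * vnorm2 v"
  unfolding vnorm2_scalar_prod by (simp add: real_sqrt_mult mult.assoc[symmetric] flip: power2_eq_square)

lemma scalar_prod_self_eq_0:
  assumes "(v :: real Matrix.vec) \<in> carrier_vec n"
  shows "v \<bullet> v = 0 \<longleftrightarrow> v = 0\<^sub>v n"
  unfolding scalar_prod_def using assms by (subst sum_nonneg_eq_0_iff) (auto intro!: eq_vecI)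

lemma vnorm2_pos:
  assumes "v \<in> carrier_vec n" "v \<noteq> 0\<^sub>v n"
  shows "vnorm2 v > 0"
  unfolding vnorm2_scalar_prod using scalar_prod_self_eq_0[OF assms(1)] scalar_prod_self_nonneg[of v] assms(2)
  by (metis less_eq_real_def real_sqrt_gt_0_iff)

lemma scalar_prod_diff_self:
  assumes "(x :: real Matrix.vec) \<in> carrier_vec n" "y \<in> carrier_vec n"
  shows "(x - y) \<bullet> (x - y) = x \<bullet> x - 2 * (x \<bullet> y) + y \<bullet> y"
  using assms comm_scalar_prod[OF assms]
  by (simp add: minus_scalar_prod_distrib[of _ n] scalar_prod_minus_distrib[of _ n])

lemma isometry_scalar_prod:
  fixes W :: "real Matrix.mat"
  assumes W: "W \<in> carrier_mat m r" "transpose_mat W * W = 1\<^sub>m r"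
    and x: "x \<in> carrier_vec r" and y: "y \<in> carrier_vec r"
  shows "transpose_mat W *\<^sub>v (W *\<^sub>v x) = x" and "(W *\<^sub>v x) \<bullet> (W *\<^sub>v y) = x \<bullet> y"
proof -
  have WWx: "transpose_mat W *\<^sub>v (W *\<^sub>v x) = x" if "x \<in> carrier_vec r" for x
    using assoc_mult_mat_vec[of "transpose_mat W" r m W r x] W that by simp
  show "(W *\<^sub>v x) \<bullet> (W *\<^sub>v y) = x \<bullet> y"
    using transpose_vec_mult_scalar[OF W(1) y, of "W *\<^sub>v x"] W(1) x WWx[OF x] by simp
  show "transpose_mat W *\<^sub>v (W *\<^sub>v x) = x" by (rule WWx[OF x])
qed

lemma isometry_vnorm2:
  fixes W :: "real Matrix.mat"
  assumes "W \<in> carrier_mat m r" "transpose_mat W * W = 1\<^sub>m r" "x \<in> carrier_vec r"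
  shows "vnorm2 (W *\<^sub>v x) = vnorm2 x"
  unfolding vnorm2_scalar_prod isometry_scalar_prod(2)[OF assms(1,2,3,3)] ..

section \<open>The pseudoinverse of an injective matrix and its norm\<close>

text \<open>The lower bound makes A^T A invertible, and (A^T A)^(-1) A^T satisfies the Penrose
  equations. This provides a witness for the choice in \<open>pinv\<close>.\<close>

lemma pinv_of_injective:
  assumes A: "A \<in> carrier_mat k r" and s: "s > 0"
    and low: "\<And>y. y \<in> carrier_vec r \<Longrightarrow> s * (y \<bullet> y) \<le> (A *\<^sub>v y) \<bullet> (A *\<^sub>v y)"
  shows "pinv A \<in> carrier_mat r k" and "pinv A * A = 1\<^sub>m r"
    and "x \<in> carrier_vec k \<Longrightarrow> sqrt s * vnorm2 (pinv A *\<^sub>v x) \<le> vnorm2 x"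
proof -
  have inj: "y = 0\<^sub>v r" if y: "y \<in> carrier_vec r" and "A *\<^sub>v y = 0\<^sub>v k" for y
  proof -
    have "s * (y \<bullet> y) \<le> 0" using low[OF y] that by simp
    then have "y \<bullet> y = 0" using s scalar_prod_self_nonneg[of y] by (simp add: mult_le_0_iff)
    then show ?thesis using scalar_prod_self_eq_0[OF y] by simp
  qed
  let ?T = "transpose_mat A"
  have T: "?T \<in> carrier_mat r k" using A by simp
  define G where "G = ?T * A"
  have G: "G \<in> carrier_mat r r" unfolding G_def using A by simp
  have GT: "transpose_mat G = G" unfolding G_def using transpose_mult[OF T A] by simp
  have "Determinant.det G \<noteq> 0"
  proof
    assume "Determinant.det G = 0"
    then obtain v where v: "v \<in> carrier_vec r" "v \<noteq> 0\<^sub>v r" "G *\<^sub>v v = 0\<^sub>v r"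
      using det_0_iff_vec_prod_zero_field[OF G] by blast
    have "(A *\<^sub>v v) \<bullet> (A *\<^sub>v v) = (G *\<^sub>v v) \<bullet> v"
      using transpose_vec_mult_scalar[OF A v(1), of "A *\<^sub>v v"] A v(1)
      unfolding G_def assoc_mult_mat_vec[OF T A v(1)] by simp
    then have "(A *\<^sub>v v) \<bullet> (A *\<^sub>v v) = 0" using v by simp
    then have "A *\<^sub>v v = 0\<^sub>v k" using scalar_prod_self_eq_0[of "A *\<^sub>v v" k] A v(1) by simp
    then show False using inj v by blast
  qed
  from det_non_zero_imp_unit[OF G this, of "()"] obtain H where H: "H \<in> carrier_mat r r" "H * G = 1\<^sub>m r" "G * H = 1\<^sub>m r"
    unfolding Units_def ring_mat_def by auto
  have HT: "transpose_mat H = H"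
  proof -
    have HtG: "transpose_mat H * G = 1\<^sub>m r" using transpose_mult[OF G H(1)] GT H(3) by simp
    have "transpose_mat H = transpose_mat H * (G * H)" using H by simp
    also have "\<dots> = transpose_mat H * G * H" using assoc_mult_mat[of "transpose_mat H" r r G r H r] G H(1) by simp
    finally show ?thesis unfolding HtG using H(1) by simp
  qed
  define B0 where "B0 = H * ?T"
  have B0: "B0 \<in> carrier_mat r k" unfolding B0_def using H(1) T by simp
  have BA: "B0 * A = 1\<^sub>m r" unfolding B0_def using assoc_mult_mat[OF H(1) T A] H(2) unfolding G_def by simp
  have "is_pinv A B0" unfolding is_pinv_def
  proof (intro conjI)
    show "B0 \<in> carrier_mat (dim_col A) (dim_row A)" using B0 A by simp
    show "A * B0 * A = A" using assoc_mult_mat[OF A B0 A] BA A by simp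
    show "B0 * A * B0 = B0" using BA B0 by simp
    show "transpose_mat (B0 * A) = B0 * A" unfolding BA by simp
    have "transpose_mat (A * B0) = transpose_mat B0 * ?T" using transpose_mult[OF A B0] .
    also have "transpose_mat B0 = A * H" unfolding B0_def using transpose_mult[OF H(1) T] HT by simp
    also have "A * H * ?T = A * B0" unfolding B0_def using assoc_mult_mat[OF A H(1) T] by simp
    finally show "transpose_mat (A * B0) = A * B0" .
  qed
  then have pinvA: "is_pinv A (pinv A)" unfolding pinv_def by (rule someI)
  define B where "B = pinv A"
  have B: "B \<in> carrier_mat r k" and ABA: "A * B * A = A" and ABT: "transpose_mat (A * B) = A * B"
    using pinvA A unfolding is_pinv_def B_def by auto
  have BAB: "B * A * B = B" using pinvA unfolding is_pinv_def B_def by simp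
  show "pinv A \<in> carrier_mat r k" using B unfolding B_def .
  \<comment> \<open>Any \<open>B\<close> with A B A = A is a left inverse here, because
    \<open>B0\<close> cancels the leading factor \<open>A\<close>.\<close>
  have "B * A = B0 * A * (B * A)" using BA B A by simp
  also have "\<dots> = B0 * (A * B * A)" using A B B0 by (simp add: assoc_mult_mat[of _ r k _ r _ r] assoc_mult_mat[of _ k r _ k _ r])
  also have "\<dots> = 1\<^sub>m r" unfolding ABA BA ..
  finally show "pinv A * A = 1\<^sub>m r" unfolding B_def .
  assume x: "x \<in> carrier_vec k"
  define P where "P = A * B"
  have P: "P \<in> carrier_mat k k" unfolding P_def using A B by simp
  have "P * P = P"
    using assoc_mult_mat[OF P A B] ABA unfolding P_def by simp
  then have PPx: "P *\<^sub>v (P *\<^sub>v x) = P *\<^sub>v x" using assoc_mult_mat_vec[OF P P x] by simp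
  have Px: "P *\<^sub>v x \<in> carrier_vec k" using P x by simp
  \<comment> \<open>P = A B is symmetric and idempotent, hence an orthogonal projection, and cannot
    increase the norm; combined with \<open>low\<close> at B x this bounds |B x|.\<close>
  have "x \<bullet> (P *\<^sub>v x) = (P *\<^sub>v x) \<bullet> (P *\<^sub>v x)"
    using sym_mat_scalar[OF P _ x Px] ABT PPx unfolding P_def by simp
  then have "(P *\<^sub>v x) \<bullet> (P *\<^sub>v x) \<le> x \<bullet> x"
    using scalar_prod_self_nonneg[of "x - P *\<^sub>v x"] scalar_prod_diff_self[OF x Px] by simp
  moreover have "P *\<^sub>v x = A *\<^sub>v (B *\<^sub>v x)" unfolding P_def using A B x by simp
  moreover have "s * ((B *\<^sub>v x) \<bullet> (B *\<^sub>v x)) \<le> (A *\<^sub>v (B *\<^sub>v x)) \<bullet> (A *\<^sub>v (B *\<^sub>v x))"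
    using low B x by simp
  ultimately have "s * ((B *\<^sub>v x) \<bullet> (B *\<^sub>v x)) \<le> x \<bullet> x" by simp
  then show "sqrt s * vnorm2 (pinv A *\<^sub>v x) \<le> vnorm2 x"
    unfolding vnorm2_scalar_prod B_def[symmetric] by (simp flip: real_sqrt_mult)
qed

lemma spec_norm_pinv:
  assumes A: "A \<in> carrier_mat k r" and s: "s > 0"
    and low: "\<And>y. y \<in> carrier_vec r \<Longrightarrow> s * (y \<bullet> y) \<le> (A *\<^sub>v y) \<bullet> (A *\<^sub>v y)"
  shows "0 \<le> spec_norm (pinv A)" and "spec_norm (pinv A) \<le> 1 / sqrt s"
    and "y \<in> carrier_vec r \<Longrightarrow> vnorm2 y \<le> spec_norm (pinv A) * vnorm2 (A *\<^sub>v y)"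
proof -
  note B = pinv_of_injective[OF assms]
  let ?N = "{vnorm2 (pinv A *\<^sub>v x) | x. x \<in> carrier_vec k \<and> vnorm2 x \<le> 1}"
  have N: "spec_norm (pinv A) = Sup ?N" unfolding spec_norm_def using B(1) by simp
  have ub: "t \<le> 1 / sqrt s" if "t \<in> ?N" for t
  proof -
    obtain x where "t = vnorm2 (pinv A *\<^sub>v x)" "x \<in> carrier_vec k" "vnorm2 x \<le> 1" using \<open>t \<in> ?N\<close> by blast
    then have "sqrt s * t \<le> 1" using B(3)[of x] by simp
    then show ?thesis using s by (simp add: field_simps)
  qed
  then have bdd: "bdd_above ?N" by (rule bdd_aboveI)
  have "vnorm2 (pinv A *\<^sub>v 0\<^sub>v k) \<in> ?N" by (auto simp: vnorm2_def intro!: exI[of _ "0\<^sub>v k"])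
  then show ge0: "0 \<le> spec_norm (pinv A)"
    unfolding N using bdd by (meson cSup_upper order_trans vnorm2_nonneg)
  show "spec_norm (pinv A) \<le> 1 / sqrt s"
    unfolding N by (rule cSup_least) (use \<open>_ \<in> ?N\<close> ub in blast)+
  assume y: "y \<in> carrier_vec r"
  have BAy: "pinv A *\<^sub>v (A *\<^sub>v y) = y"
    using assoc_mult_mat_vec[OF B(1) A y] B(2) y by simp
  show "vnorm2 y \<le> spec_norm (pinv A) * vnorm2 (A *\<^sub>v y)"
  proof (cases "vnorm2 (A *\<^sub>v y) = 0")
    case True
    then have "sqrt s * vnorm2 y \<le> 0" using B(3)[of "A *\<^sub>v y"] A y BAy by simp
    then show ?thesis using True s by (simp add: mult_le_0_iff)
  next
    case False
    \<comment> \<open>Scaling A y to norm 1 puts it among the vectors of the supremum; the left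
      inverse then recovers y.\<close>
    define c where "c = 1 / vnorm2 (A *\<^sub>v y)"
    have c: "c > 0" unfolding c_def using False vnorm2_nonneg[of "A *\<^sub>v y"] by simp
    have "vnorm2 (pinv A *\<^sub>v (c \<cdot>\<^sub>v (A *\<^sub>v y))) \<in> ?N"
      using A y c by (auto simp: vnorm2_smult c_def intro!: exI[of _ "c \<cdot>\<^sub>v (A *\<^sub>v y)"])
    moreover have "pinv A *\<^sub>v (c \<cdot>\<^sub>v (A *\<^sub>v y)) = c \<cdot>\<^sub>v y"
      using mult_mat_vec[OF B(1), of "A *\<^sub>v y" c] A y BAy by simp
    ultimately have "c * vnorm2 y \<in> ?N" using c by (simp add: vnorm2_smult)
    then have "c * vnorm2 y \<le> spec_norm (pinv A)" unfolding N using bdd by (rule cSup_upper)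
    then show ?thesis unfolding c_def using False vnorm2_nonneg[of "A *\<^sub>v y"] by (simp add: field_simps)
  qed
qed

section \<open>Singular values as eigenvalues of the Gram matrix\<close>

lemma sing_valsE:
  assumes "A \<in> carrier_mat m n" "s \<in> sing_vals A"
  obtains x where "s > 0" "x \<in> carrier_vec n" "x \<noteq> 0\<^sub>v n" "transpose_mat A *\<^sub>v (A *\<^sub>v x) = s\<^sup>2 \<cdot>\<^sub>v x"
  using assms assoc_mult_mat_vec[of "transpose_mat A" n m A n] unfolding sing_vals_def eigenvalue_def eigenvector_def by auto

lemma sing_valsI:
  assumes "A \<in> carrier_mat m n" "s > 0" "x \<in> carrier_vec n" "x \<noteq> 0\<^sub>v n" "transpose_mat A *\<^sub>v (A *\<^sub>v x) = s\<^sup>2 \<cdot>\<^sub>v x"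
  shows "s \<in> sing_vals A"
  using assms assoc_mult_mat_vec[of "transpose_mat A" n m A n x] unfolding sing_vals_def eigenvalue_def eigenvector_def by auto

lemma finite_sing_vals:
  assumes A: "A \<in> carrier_mat m n"
  shows "finite (sing_vals A)"
proof -
  let ?p = "char_poly (transpose_mat A * A)"
  have G: "transpose_mat A * A \<in> carrier_mat n n" using A by simp
  have "?p \<noteq> 0" using degree_monic_char_poly[OF G] by auto
  then have "finite (sqrt ` {x. poly ?p x = 0})" by (intro finite_imageI poly_roots_finite)
  moreover have "sing_vals A \<subseteq> sqrt ` {x. poly ?p x = 0}"
  proof
    fix s assume "s \<in> sing_vals A"
    then have "s > 0" "poly ?p (s\<^sup>2) = 0" using eigenvalue_root_char_poly[OF G] unfolding sing_vals_def by auto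
    then show "s \<in> sqrt ` {x. poly ?p x = 0}" by (intro image_eqI[of _ _ "s\<^sup>2"]) auto
  qed
  ultimately show ?thesis by (rule finite_subset[rotated])
qed

text \<open>With y = A^T w one has w . A y = |y|^2, so A y is nonzero. Thus A^T A has a positive
  value at y and hence a positive eigenvalue. Nonemptiness makes \<open>Max\<close> and
  \<open>Min\<close> in \<open>cond_num\<close> meaningful.\<close>

lemma sing_vals_nonempty:
  assumes A: "A \<in> carrier_mat m n" and w: "w \<in> carrier_vec m" and Aw: "transpose_mat A *\<^sub>v w \<noteq> 0\<^sub>v n"
  shows "sing_vals A \<noteq> {}"
proof -
  define y where "y = transpose_mat A *\<^sub>v w"
  define G where "G = transpose_mat A * A"
  have y: "y \<in> carrier_vec n" unfolding y_def using A w by simp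
  have G: "G \<in> carrier_mat n n" "transpose_mat G = G"
    unfolding G_def using A transpose_mult[of "transpose_mat A" n m A n] by simp_all
  obtain a u where u: "eigbasis n G a u" using eigbasis_exists[OF G] by blast
  have Gx: "G *\<^sub>v x = transpose_mat A *\<^sub>v (A *\<^sub>v x)" if "x \<in> carrier_vec n" for x
    unfolding G_def using A that by simp
  have "w \<bullet> (A *\<^sub>v y) = y \<bullet> y"
    using transpose_vec_mult_scalar[OF A y w] unfolding y_def by simp
  then have "A *\<^sub>v y \<noteq> 0\<^sub>v m"
    using scalar_prod_self_eq_0[OF y] Aw w unfolding y_def by auto
  then have "(A *\<^sub>v y) \<bullet> (A *\<^sub>v y) \<noteq> 0" using scalar_prod_self_eq_0[of "A *\<^sub>v y" m] A y by simp
  then have pos: "(A *\<^sub>v y) \<bullet> (A *\<^sub>v y) > 0" using scalar_prod_self_nonneg[of "A *\<^sub>v y"] by simp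
  have "(A *\<^sub>v y) \<bullet> (A *\<^sub>v y) = (G *\<^sub>v y) \<bullet> y"
    using transpose_vec_mult_scalar[OF A y, of "A *\<^sub>v y"] A y Gx[OF y] by simp
  also have "\<dots> = y \<bullet> (G *\<^sub>v y)" by (rule sym_mat_scalar[OF G y y])
  also have "\<dots> = (\<Sum>i<n. (u i \<bullet> y) * (u i \<bullet> (G *\<^sub>v y)))"
    by (rule eigbasis_expand[OF u y mult_mat_vec_carrier[OF G(1) y]])
  also have "\<dots> = (\<Sum>i<n. a i * (u i \<bullet> y)\<^sup>2)"
    by (intro sum.cong refl) (simp add: eigbasis_bilinear[OF G u y] power2_eq_square)
  finally have "(\<Sum>i<n. a i * (u i \<bullet> y)\<^sup>2) > 0" using pos by simp
  then obtain i where i: "i < n" "a i * (u i \<bullet> y)\<^sup>2 > 0"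
    by (meson lessThan_iff not_less sum_nonpos)
  then have a: "a i > 0" by (simp add: zero_less_mult_iff)
  have "u i \<noteq> 0\<^sub>v n" using eigbasisD(1,3)[OF u i(1)] by auto
  then have "sqrt (a i) \<in> sing_vals A"
    using sing_valsI[OF A, of "sqrt (a i)" "u i"] a eigbasisD(1,2)[OF u i(1)] Gx by simp
  then show ?thesis by blast
qed

subsection \<open>Singular value decompositions of column samples\<close>

lemma vnorm2_zero: "vnorm2 (0\<^sub>v n) = 0"
  by (simp add: vnorm2_def)

lemma diag_mat_vnorm2_bounds:
  fixes S :: "real Matrix.mat"
  assumes S: "S \<in> carrier_mat r r" and diag: "\<And>i j. i < r \<Longrightarrow> j < r \<Longrightarrow> i \<noteq> j \<Longrightarrow> S $$ (i,j) = 0"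
    and z: "z \<in> carrier_vec r"
  shows "i < r \<Longrightarrow> (S *\<^sub>v z) $ i = S $$ (i,i) * z $ i"
    and "0 \<le> a \<Longrightarrow> (\<And>i. i < r \<Longrightarrow> a \<le> S $$ (i,i)) \<Longrightarrow> a * vnorm2 z \<le> vnorm2 (S *\<^sub>v z)"
    and "0 \<le> b \<Longrightarrow> (\<And>i. i < r \<Longrightarrow> 0 \<le> S $$ (i,i) \<and> S $$ (i,i) \<le> b) \<Longrightarrow> vnorm2 (S *\<^sub>v z) \<le> b * vnorm2 z"
proof -
  show Sz: "(S *\<^sub>v z) $ i = S $$ (i,i) * z $ i" if "i < r" for i
  proof -
    have "(S *\<^sub>v z) $ i = (\<Sum>j<r. S $$ (i,j) * z $ j)"
      using that S z by (simp add: scalar_prod_def lessThan_atLeast0)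
    also have "\<dots> = (\<Sum>j\<in>{i}. S $$ (i,j) * z $ j)"
      by (intro sum.mono_neutral_right) (use that diag in auto)
    finally show ?thesis by simp
  qed
  have N: "vnorm2 (S *\<^sub>v z) = sqrt (\<Sum>i<r. (S $$ (i,i) * z $ i)\<^sup>2)"
    unfolding vnorm2_def using S Sz by (auto intro!: arg_cong[of _ _ sqrt] sum.cong)
  have cN: "c * vnorm2 z = sqrt (\<Sum>i<r. (c * z $ i)\<^sup>2)" if "c \<ge> 0" for c
    unfolding vnorm2_def using z that
    by (simp add: power_mult_distrib real_sqrt_mult flip: sum_distrib_left)
  show "a * vnorm2 z \<le> vnorm2 (S *\<^sub>v z)" if "0 \<le> a" and a: "\<And>i. i < r \<Longrightarrow> a \<le> S $$ (i,i)"
    unfolding N cN[OF \<open>0 \<le> a\<close>] power_mult_distrib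
    by (intro real_sqrt_le_mono sum_mono mult_right_mono power_mono) (use that in auto)
  show "vnorm2 (S *\<^sub>v z) \<le> b * vnorm2 z" if "0 \<le> b" and b: "\<And>i. i < r \<Longrightarrow> 0 \<le> S $$ (i,i) \<and> S $$ (i,i) \<le> b"
    unfolding N cN[OF \<open>0 \<le> b\<close>] power_mult_distrib
    by (intro real_sqrt_le_mono sum_mono mult_right_mono power_mono) (use that in auto)
qed

lemma compact_svdD:
  assumes svd: "compact_svd A W S V r" and A: "A \<in> carrier_mat m n"
  shows "W \<in> carrier_mat m r" "S \<in> carrier_mat r r" "V \<in> carrier_mat n r"
    "transpose_mat W * W = 1\<^sub>m r" "transpose_mat V * V = 1\<^sub>m r"
    "\<And>i j. i < r \<Longrightarrow> j < r \<Longrightarrow> i \<noteq> j \<Longrightarrow> S $$ (i,j) = 0"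
    "\<And>i. i < r \<Longrightarrow> S $$ (i,i) > 0"
    "\<And>i j. i \<le> j \<Longrightarrow> j < r \<Longrightarrow> S $$ (j,j) \<le> S $$ (i,i)"
    "A = W * S * transpose_mat V" "transpose_mat S = S"
proof -
  show "W \<in> carrier_mat m r" and S: "S \<in> carrier_mat r r" and "V \<in> carrier_mat n r"
    "transpose_mat W * W = 1\<^sub>m r" "transpose_mat V * V = 1\<^sub>m r" "A = W * S * transpose_mat V"
    using svd A unfolding compact_svd_def by auto
  show diag: "S $$ (i,j) = 0" if "i < r" "j < r" "i \<noteq> j" for i j
    using svd that unfolding compact_svd_def by blast
  show "S $$ (i,i) > 0" if "i < r" for i
    using svd that unfolding compact_svd_def by blast
  show "S $$ (j,j) \<le> S $$ (i,i)" if "i \<le> j" "j < r" for i j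
    using svd that unfolding compact_svd_def by blast
  show "transpose_mat S = S"
  proof (rule eq_matI)
    fix i j assume "i < dim_row S" "j < dim_col S"
    then show "transpose_mat S $$ (i,j) = S $$ (i,j)" using S diag by (cases "i = j") auto
  qed (use S in auto)
qed

lemma factored_mult:
  fixes W S V :: "real Matrix.mat"
  assumes W: "W \<in> carrier_mat m r" and S: "S \<in> carrier_mat r r" "transpose_mat S = S" and V: "V \<in> carrier_mat n r"
  defines "A \<equiv> W * S * transpose_mat V"
  shows "x \<in> carrier_vec n \<Longrightarrow> A *\<^sub>v x = W *\<^sub>v (S *\<^sub>v (transpose_mat V *\<^sub>v x))"
    and "w \<in> carrier_vec m \<Longrightarrow> transpose_mat A *\<^sub>v w = V *\<^sub>v (S *\<^sub>v (transpose_mat W *\<^sub>v w))"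
proof -
  have VT: "transpose_mat V \<in> carrier_mat r n" using V by simp
  have WT: "transpose_mat W \<in> carrier_mat r m" using W by simp
  have WS: "W * S \<in> carrier_mat m r" using W S by simp
  show "A *\<^sub>v x = W *\<^sub>v (S *\<^sub>v (transpose_mat V *\<^sub>v x))" if x: "x \<in> carrier_vec n"
    unfolding A_def assoc_mult_mat_vec[OF WS VT x]
    by (rule assoc_mult_mat_vec[OF W S(1) mult_mat_vec_carrier[OF VT x]])
  have AT: "transpose_mat A = V * (S * transpose_mat W)"
    unfolding A_def using transpose_mult[OF WS VT] transpose_mult[OF W S(1)] S(2) by simp
  show "transpose_mat A *\<^sub>v w = V *\<^sub>v (S *\<^sub>v (transpose_mat W *\<^sub>v w))" if w: "w \<in> carrier_vec m"
    unfolding AT using assoc_mult_mat_vec[OF V mult_carrier_mat[OF S(1) WT] w] assoc_mult_mat_vec[OF S(1) WT w] by simp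
qed

text \<open>The vector V e_i is a right singular vector: A sends it to S_ii W e_i, and the transpose
  of A sends W e_i back to S_ii V e_i.\<close>

lemma compact_svd_sing_val:
  assumes svd: "compact_svd A W S V r" and A: "A \<in> carrier_mat m n" and i: "i < r"
  shows "S $$ (i,i) \<in> sing_vals A"
proof -
  note d = compact_svdD[OF svd A]
  let ?e = "unit_vec r i :: real Matrix.vec"
  have Se: "S *\<^sub>v ?e = S $$ (i,i) \<cdot>\<^sub>v ?e"
  proof (rule eq_vecI)
    fix j assume "j < dim_vec (S $$ (i,i) \<cdot>\<^sub>v ?e)"
    then have j: "j < r" by simp
    then show "(S *\<^sub>v ?e) $ j = (S $$ (i,i) \<cdot>\<^sub>v ?e) $ j"
      using i d(2) d(6)[OF j i] by (cases "j = i") (auto simp: scalar_prod_right_unit)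
  qed (use d(2) in auto)
  have e: "?e \<in> carrier_vec r" by simp
  have Ve: "V *\<^sub>v ?e \<in> carrier_vec n" using d(3) by simp
  have We: "W *\<^sub>v ?e \<in> carrier_vec m" using d(1) by simp
  have "A *\<^sub>v (V *\<^sub>v ?e) = S $$ (i,i) \<cdot>\<^sub>v (W *\<^sub>v ?e)"
    using factored_mult(1)[OF d(1,2,10,3) Ve] isometry_scalar_prod(1)[OF d(3,5) e e] Se
      mult_mat_vec[OF d(1) e] unfolding d(9)[symmetric] by simp
  moreover have "transpose_mat A *\<^sub>v (W *\<^sub>v ?e) = S $$ (i,i) \<cdot>\<^sub>v (V *\<^sub>v ?e)"
    using factored_mult(2)[OF d(1,2,10,3) We] isometry_scalar_prod(1)[OF d(1,4) e e] Se
      mult_mat_vec[OF d(3) e] unfolding d(9)[symmetric] by simp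
  ultimately have "transpose_mat A *\<^sub>v (A *\<^sub>v (V *\<^sub>v ?e)) = (S $$ (i,i))\<^sup>2 \<cdot>\<^sub>v (V *\<^sub>v ?e)"
    using mult_mat_vec[of "transpose_mat A" n m "W *\<^sub>v ?e" "S $$ (i,i)"] A We
    by (simp add: smult_smult_assoc power2_eq_square)
  moreover have "V *\<^sub>v ?e \<noteq> 0\<^sub>v n"
    using isometry_scalar_prod(2)[OF d(3,5) e e] i by auto
  ultimately show ?thesis using sing_valsI[OF A d(7)[OF i] Ve] by blast
qed

lemma cond_num_ge:
  assumes svd: "compact_svd A W S V r" and A: "A \<in> carrier_mat m n" and ij: "i < r" "j < r"
  shows "S $$ (i,i) / S $$ (j,j) \<le> cond_num A"
proof -
  note fin = finite_sing_vals[OF A]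
  note mem = compact_svd_sing_val[OF svd A]
  have "Min (sing_vals A) \<in> sing_vals A" using fin mem[OF ij(1)] by (intro Min_in) auto
  then have "Min (sing_vals A) > 0" unfolding sing_vals_def by auto
  moreover have "Min (sing_vals A) \<le> S $$ (j,j)" "S $$ (i,i) \<le> Max (sing_vals A)"
    using fin mem ij by auto
  moreover have "S $$ (i,i) > 0" using compact_svdD(7)[OF svd A ij(1)] .
  ultimately show ?thesis unfolding cond_num_def by (intro frac_le) auto
qed

section \<open>Singular values and incoherence of a column sample\<close>

text \<open>\<open>V\<close> stands for \<open>V\<^sub>L(J,:)\<close>, \<open>\<rho>\<close> for the norm of its pseudoinverse and \<open>b\<close> for a bound on its norm.\<close>

locale column_sample =
  fixes m k r :: nat and W S V C :: "real Matrix.mat" and \<rho> b smin smax :: real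
  assumes W: "W \<in> carrier_mat m r" "transpose_mat W * W = 1\<^sub>m r"
    and S: "S \<in> carrier_mat r r" "transpose_mat S = S"
      "\<And>i j. i < r \<Longrightarrow> j < r \<Longrightarrow> i \<noteq> j \<Longrightarrow> S $$ (i,j) = 0"
    and smin: "0 < smin" "\<And>i. i < r \<Longrightarrow> smin \<le> S $$ (i,i)"
    and smax: "\<And>i. i < r \<Longrightarrow> S $$ (i,i) \<le> smax" "0 < smax"
    and V: "V \<in> carrier_mat k r" and C: "C = W * S * transpose_mat V"
    and low: "\<And>y. y \<in> carrier_vec r \<Longrightarrow> vnorm2 y \<le> \<rho> * vnorm2 (V *\<^sub>v y)"
    and high: "\<And>y. y \<in> carrier_vec r \<Longrightarrow> vnorm2 (V *\<^sub>v y) \<le> b * vnorm2 y"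
    and r: "r > 0"
begin

lemma C_carrier: "C \<in> carrier_mat m k"
  unfolding C using W S V by simp

lemma S_bounds:
  assumes "z \<in> carrier_vec r"
  shows "smin * vnorm2 z \<le> vnorm2 (S *\<^sub>v z)" "vnorm2 (S *\<^sub>v z) \<le> smax * vnorm2 z"
proof -
  show "smin * vnorm2 z \<le> vnorm2 (S *\<^sub>v z)"
    by (rule diag_mat_vnorm2_bounds(2)[OF S(1,3) assms]) (use smin in auto)
  show "vnorm2 (S *\<^sub>v z) \<le> smax * vnorm2 z"
    by (rule diag_mat_vnorm2_bounds(3)[OF S(1,3) assms]) (use smin smax in \<open>force+\<close>)
qed

lemma C_mult: "x \<in> carrier_vec k \<Longrightarrow> C *\<^sub>v x = W *\<^sub>v (S *\<^sub>v (transpose_mat V *\<^sub>v x))"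
  and CT_mult: "w \<in> carrier_vec m \<Longrightarrow> transpose_mat C *\<^sub>v w = V *\<^sub>v (S *\<^sub>v (transpose_mat W *\<^sub>v w))"
  using factored_mult[OF W(1) S(1,2) V] unfolding C by auto

lemma \<rho>_pos: "\<rho> > 0"
proof -
  let ?e = "unit_vec r 0 :: real Matrix.vec"
  have "vnorm2 ?e > 0" by (rule vnorm2_pos[of _ r]) (use r in auto)
  then have "\<rho> * vnorm2 (V *\<^sub>v ?e) > 0" using low[of ?e] by simp
  then show ?thesis using vnorm2_nonneg by (metis less_eq_real_def mult_nonpos_nonneg not_less)
qed

text \<open>C itself may have a kernel, but on the range of \<open>W\<close> its transpose acts as V
  S, which is bounded below.\<close>

lemma CT_lower:
  assumes q: "q \<in> carrier_vec r"
  shows "smin / \<rho> * vnorm2 q \<le> vnorm2 (transpose_mat C *\<^sub>v (W *\<^sub>v q))"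
proof -
  have "smin * vnorm2 q \<le> vnorm2 (S *\<^sub>v q)" by (rule S_bounds(1)[OF q])
  also have "\<dots> \<le> \<rho> * vnorm2 (V *\<^sub>v (S *\<^sub>v q))" using S(1) q by (intro low) simp
  also have "V *\<^sub>v (S *\<^sub>v q) = transpose_mat C *\<^sub>v (W *\<^sub>v q)"
    using CT_mult[of "W *\<^sub>v q"] W q isometry_scalar_prod(1)[OF W q q] by simp
  finally show ?thesis using \<rho>_pos by (simp add: field_simps)
qed

lemma sing_vals_bounds:
  assumes "s \<in> sing_vals C"
  shows "smin / \<rho> \<le> s" "s \<le> b * smax"
proof -
  obtain x where s: "s > 0" and x: "x \<in> carrier_vec k" "x \<noteq> 0\<^sub>v k" "transpose_mat C *\<^sub>v (C *\<^sub>v x) = s\<^sup>2 \<cdot>\<^sub>v x"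
    using sing_valsE[OF C_carrier assms] by blast
  \<comment> \<open>The left singular vector lies in the range of \<open>W\<close>, where
    \<open>CT_lower\<close> applies, and C^T stretches it by exactly \<open>s\<close>.\<close>
  define w where "w = C *\<^sub>v x"
  define q where "q = S *\<^sub>v (transpose_mat V *\<^sub>v x)"
  have q: "q \<in> carrier_vec r" unfolding q_def using S V x by simp
  have w: "w \<in> carrier_vec m" unfolding w_def using C_carrier x by simp
  have wq: "w = W *\<^sub>v q" unfolding w_def q_def by (rule C_mult[OF x(1)])
  have "w \<bullet> w = s\<^sup>2 * (x \<bullet> x)"
    using transpose_vec_mult_scalar[OF C_carrier x(1) w] x unfolding w_def by simp
  then have Nw: "vnorm2 w = s * vnorm2 x" unfolding vnorm2_scalar_prod using s by (simp add: real_sqrt_mult)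
  have CTw: "vnorm2 (transpose_mat C *\<^sub>v w) = s * vnorm2 w"
    unfolding Nw unfolding w_def x(3) using s by (simp add: vnorm2_smult power2_eq_square)
  have pos: "vnorm2 w > 0" unfolding Nw using s vnorm2_pos[OF x(1,2)] by simp
  have "smin / \<rho> * vnorm2 w \<le> s * vnorm2 w"
    using CT_lower[OF q] CTw isometry_vnorm2[OF W q] unfolding wq by simp
  then show "smin / \<rho> \<le> s" using pos by (rule mult_right_le_imp_le)
  have "s * vnorm2 w = vnorm2 (V *\<^sub>v (S *\<^sub>v (transpose_mat W *\<^sub>v w)))"
    using CTw CT_mult[OF w] by simp
  also have "\<dots> \<le> b * vnorm2 (S *\<^sub>v (transpose_mat W *\<^sub>v w))" using S W w by (intro high) simp
  also have "S *\<^sub>v (transpose_mat W *\<^sub>v w) = S *\<^sub>v q" unfolding wq isometry_scalar_prod(1)[OF W q q] ..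
  finally have 1: "s * vnorm2 w \<le> b * vnorm2 (S *\<^sub>v q)" .
  \<comment> \<open>A nonpositive \<open>b\<close> would make the right side nonpositive, while
    \<open>s\<close> and |w| are positive.\<close>
  then have "b > 0" using s pos vnorm2_nonneg[of "S *\<^sub>v q"]
    by (smt (verit) mult_pos_pos mult_nonpos_nonneg)
  then have "b * vnorm2 (S *\<^sub>v q) \<le> b * (smax * vnorm2 q)" using S_bounds(2)[OF q] by simp
  with 1 have "s * vnorm2 w \<le> (b * smax) * vnorm2 w"
    using isometry_vnorm2[OF W q] unfolding wq by simp
  then show "s \<le> b * smax" using pos by simp
qed

lemma cond_num_le: "cond_num C \<le> b * \<rho> * (smax / smin)"
proof -
  let ?e = "unit_vec r 0 :: real Matrix.vec"
  have e: "?e \<in> carrier_vec r" by simp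
  have "vnorm2 ?e > 0" by (rule vnorm2_pos[of _ r]) (use r in auto)
  then have "vnorm2 (transpose_mat C *\<^sub>v (W *\<^sub>v ?e)) > 0"
    using CT_lower[OF e] smin \<rho>_pos by (smt (verit) divide_pos_pos mult_pos_pos)
  then have "transpose_mat C *\<^sub>v (W *\<^sub>v ?e) \<noteq> 0\<^sub>v k" by (metis vnorm2_zero less_irrefl)
  then have ne: "sing_vals C \<noteq> {}"
    using W by (intro sing_vals_nonempty[OF C_carrier]) auto
  note fin = finite_sing_vals[OF C_carrier]
  have "smin / \<rho> \<le> Min (sing_vals C)" "Max (sing_vals C) \<le> b * smax" "Max (sing_vals C) > 0"
    using sing_vals_bounds ne fin Max_in[OF fin ne] by (auto simp: sing_vals_def)
  then have "cond_num C \<le> b * smax / (smin / \<rho>)"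
    unfolding cond_num_def using smin \<rho>_pos by (intro frac_le) auto
  then show ?thesis by (simp add: mult_ac)
qed

text \<open>The norm of the i-th column of C is computed from both factorisations: at least
  smin/\<rho> times the row norm of V', and at most smax times the row norm of V.\<close>

lemma right_incoherence:
  assumes svd: "compact_svd C W' S' V' r'" and i: "i < k"
    and row: "vnorm2 (transpose_mat V *\<^sub>v unit_vec k i) \<le> c"
  shows "vnorm2 (transpose_mat V' *\<^sub>v unit_vec k i) \<le> \<rho> * (smax / smin) * c"
proof -
  note d = compact_svdD[OF svd C_carrier]
  let ?e = "unit_vec k i :: real Matrix.vec"
  have e: "?e \<in> carrier_vec k" by simp
  define z where "z = transpose_mat V' *\<^sub>v ?e"
  have z: "z \<in> carrier_vec r'" unfolding z_def using d(3) by simp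
  have Sz: "S' *\<^sub>v z \<in> carrier_vec r'" using d(2) z by simp
  have VTe: "transpose_mat V *\<^sub>v ?e \<in> carrier_vec r" using V by simp
  have "smin / \<rho> * vnorm2 z \<le> vnorm2 (S' *\<^sub>v z)"
    by (rule diag_mat_vnorm2_bounds(2)[OF d(2) d(6) z])
      (use smin \<rho>_pos sing_vals_bounds(1)[OF compact_svd_sing_val[OF svd C_carrier]] in auto)
  also have "\<dots> = vnorm2 (W' *\<^sub>v (S' *\<^sub>v z))" by (rule isometry_vnorm2[OF d(1,4) Sz, symmetric])
  also have "W' *\<^sub>v (S' *\<^sub>v z) = C *\<^sub>v ?e"
    unfolding z_def using factored_mult(1)[OF d(1,2,10,3) e] unfolding d(9)[symmetric] by simp
  also have "vnorm2 (C *\<^sub>v ?e) = vnorm2 (S *\<^sub>v (transpose_mat V *\<^sub>v ?e))"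
    unfolding C_mult[OF e] using S V by (intro isometry_vnorm2[OF W]) simp
  also have "\<dots> \<le> smax * vnorm2 (transpose_mat V *\<^sub>v ?e)" by (rule S_bounds(2)[OF VTe])
  also have "\<dots> \<le> smax * c" using row smax by simp
  finally show ?thesis unfolding z_def using smin \<rho>_pos by (simp add: field_simps)
qed

text \<open>The range of W' lies in the range of W, and projecting a unit vector onto a smaller
  subspace gives a shorter vector.\<close>

lemma left_incoherence:
  assumes svd: "compact_svd C W' S' V' r'" and i: "i < m"
  shows "vnorm2 (transpose_mat W' *\<^sub>v unit_vec m i) \<le> vnorm2 (transpose_mat W *\<^sub>v unit_vec m i)"
proof (rule vnorm2_leI)
  note d = compact_svdD[OF svd C_carrier]
  let ?e = "unit_vec m i :: real Matrix.vec"
  have e: "?e \<in> carrier_vec m" by simp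
  define z where "z = transpose_mat W' *\<^sub>v ?e"
  define p where "p = transpose_mat W *\<^sub>v ?e"
  have z: "z \<in> carrier_vec r'" unfolding z_def using d(1) by simp
  have p: "p \<in> carrier_vec r" unfolding p_def using W by simp
  \<comment> \<open>This inverts S', so that C V' y = W' z, which exhibits W' z as an element W q of
    the range of W.\<close>
  define y where "y = Matrix.vec r' (\<lambda>j. z $ j / S' $$ (j,j))"
  have y: "y \<in> carrier_vec r'" unfolding y_def by simp
  have Vy: "V' *\<^sub>v y \<in> carrier_vec k" using d(3) y by simp
  have Sy: "S' *\<^sub>v y = z"
  proof (rule eq_vecI)
    fix j assume "j < dim_vec z"
    then have j: "j < r'" using z by simp
    show "(S' *\<^sub>v y) $ j = z $ j"
      using diag_mat_vnorm2_bounds(1)[OF d(2) d(6) y j] d(7)[OF j] j unfolding y_def by simp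
  qed (use d(2) z in auto)
  define q where "q = S *\<^sub>v (transpose_mat V *\<^sub>v (V' *\<^sub>v y))"
  have q: "q \<in> carrier_vec r" unfolding q_def using S V Vy by simp
  have Wq: "W *\<^sub>v q = W' *\<^sub>v z"
  proof -
    have "W *\<^sub>v q = C *\<^sub>v (V' *\<^sub>v y)" unfolding q_def C_mult[OF Vy] ..
    also have "\<dots> = W' *\<^sub>v z"
      using factored_mult(1)[OF d(1,2,10,3) Vy] isometry_scalar_prod(1)[OF d(3,5) y y] Sy
      unfolding d(9)[symmetric] by simp
    finally show ?thesis .
  qed
  have "q \<bullet> q = z \<bullet> z"
    using isometry_scalar_prod(2)[OF W q q] isometry_scalar_prod(2)[OF d(1,4) z z] unfolding Wq by simp
  \<comment> \<open>Both products equal the pairing of e_i with W q = W' z. Hence |p - q|^2 = |p|^2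
    - |z|^2, which is nonnegative.\<close>
  moreover have "p \<bullet> q = z \<bullet> z"
    using transpose_vec_mult_scalar[OF W(1) q e] transpose_vec_mult_scalar[OF d(1) z e]
    unfolding Wq p_def z_def by simp
  ultimately show "z \<bullet> z \<le> p \<bullet> p"
    using scalar_prod_self_nonneg[of "p - q"] scalar_prod_diff_self[OF p q] by simp
qed

end

section \<open>Submatrices selected by an index set\<close>

lemma bij_betw_pick:
  assumes "finite J"
  shows "bij_betw (pick J) {..<card J} J"
proof (rule bij_betwI')
  fix i j assume ij: "i \<in> {..<card J}" "j \<in> {..<card J}"
  show "(pick J i = pick J j) = (i = j)"
    using ij pick_mono_le[of i J j] pick_mono_le[of j J i] by (metis lessThan_iff less_irrefl linorder_neqE_nat)
next
  fix i assume "i \<in> {..<card J}"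
  then show "pick J i \<in> J" by (auto intro: pick_in_set_le)
next
  fix j assume j: "j \<in> J"
  have "card {a\<in>J. a < j} < card J" using assms j by (intro psubset_card_mono) auto
  then show "\<exists>i\<in>{..<card J}. j = pick J i" using pick_card_in_set[OF j] by force
qed

lemma submatrix_dims:
  assumes "J \<subseteq> {..<n}"
  shows "A \<in> carrier_mat m n \<Longrightarrow> submatrix A UNIV J \<in> carrier_mat m (card J)"
    and "B \<in> carrier_mat n r \<Longrightarrow> submatrix B J UNIV \<in> carrier_mat (card J) r"
proof -
  have c: "card {j. j < n \<and> j \<in> J} = card J" using assms by (intro arg_cong[of _ _ card]) auto
  show "submatrix A UNIV J \<in> carrier_mat m (card J)" if A: "A \<in> carrier_mat m n"
  proof (rule carrier_matI)
    show "dim_row (submatrix A UNIV J) = m" unfolding dim_submatrix(1) using A by simp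
    show "dim_col (submatrix A UNIV J) = card J" unfolding dim_submatrix(2) carrier_matD(2)[OF A] by (rule c)
  qed
  show "submatrix B J UNIV \<in> carrier_mat (card J) r" if B: "B \<in> carrier_mat n r"
  proof (rule carrier_matI)
    show "dim_row (submatrix B J UNIV) = card J" unfolding dim_submatrix(1) carrier_matD(1)[OF B] by (rule c)
    show "dim_col (submatrix B J UNIV) = r" unfolding dim_submatrix(2) using B by simp
  qed
qed

lemma pick_less:
  assumes "J \<subseteq> {..<n}" "i < card J"
  shows "pick J i < n" "pick J i \<in> J"
  using pick_in_set_le[OF assms(2)] assms(1) by auto

lemma submatrix_nth:
  assumes J: "J \<subseteq> {..<n}"
  shows "A \<in> carrier_mat m n \<Longrightarrow> i < m \<Longrightarrow> j < card J \<Longrightarrow> submatrix A UNIV J $$ (i,j) = A $$ (i, pick J j)"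
    and "B \<in> carrier_mat n r \<Longrightarrow> i < card J \<Longrightarrow> j < r \<Longrightarrow> submatrix B J UNIV $$ (i,j) = B $$ (pick J i, j)"
proof -
  have c: "card {j. j < n \<and> j \<in> J} = card J" using J by (intro arg_cong[of _ _ card]) auto
  show "submatrix A UNIV J $$ (i,j) = A $$ (i, pick J j)" if A: "A \<in> carrier_mat m n" and ij: "i < m" "j < card J"
    using submatrix_index[of i A UNIV j J] ij c unfolding carrier_matD[OF A] pick_UNIV by simp
  show "submatrix B J UNIV $$ (i,j) = B $$ (pick J i, j)" if B: "B \<in> carrier_mat n r" and ij: "i < card J" "j < r"
    using submatrix_index[of i B J j UNIV] ij c unfolding carrier_matD[OF B] pick_UNIV by simp
qed

lemma row_submatrix:
  assumes J: "J \<subseteq> {..<n}" and V: "V \<in> carrier_mat n r" and j: "j < card J"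
  shows "Matrix.row (submatrix V J UNIV) j = Matrix.row V (pick J j)"
  using submatrix_dims(2)[OF J V] V pick_less[OF J j] submatrix_nth(2)[OF J V j] j by (intro eq_vecI) auto

lemma submatrix_mult_transpose:
  fixes W V :: "real Matrix.mat"
  assumes J: "J \<subseteq> {..<n}" and W: "W \<in> carrier_mat m r" and V: "V \<in> carrier_mat n r"
  shows "submatrix (W * transpose_mat V) UNIV J = W * transpose_mat (submatrix V J UNIV)"
proof (rule eq_matI)
  note dims = submatrix_dims[OF J]
  have A: "W * transpose_mat V \<in> carrier_mat m n" using W V by simp
  show "dim_row (submatrix (W * transpose_mat V) UNIV J) = dim_row (W * transpose_mat (submatrix V J UNIV))"
    "dim_col (submatrix (W * transpose_mat V) UNIV J) = dim_col (W * transpose_mat (submatrix V J UNIV))"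
    using dims(1)[OF A] dims(2)[OF V] W by auto
  fix i j assume "i < dim_row (W * transpose_mat (submatrix V J UNIV))" "j < dim_col (W * transpose_mat (submatrix V J UNIV))"
  then have ij: "i < m" "j < card J" using dims(2)[OF V] W by auto
  have "Matrix.row (submatrix V J UNIV) j = Matrix.row V (pick J j)" by (rule row_submatrix[OF J V ij(2)])
  then show "submatrix (W * transpose_mat V) UNIV J $$ (i,j) = (W * transpose_mat (submatrix V J UNIV)) $$ (i,j)"
    using submatrix_nth(1)[OF J A ij] W V dims(2)[OF V] pick_less[OF J ij(2)] ij by simp
qed

lemma submatrix_mult_vec_sq:
  fixes V :: "real Matrix.mat"
  assumes J: "J \<subseteq> {..<n}" and V: "V \<in> carrier_mat n r"
  shows "(submatrix V J UNIV *\<^sub>v y) \<bullet> (submatrix V J UNIV *\<^sub>v y) = (\<Sum>j\<in>J. (Matrix.row V j \<bullet> y)\<^sup>2)"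
proof -
  have "(submatrix V J UNIV *\<^sub>v y) \<bullet> (submatrix V J UNIV *\<^sub>v y) = (\<Sum>i<card J. (Matrix.row V (pick J i) \<bullet> y)\<^sup>2)"
    using submatrix_dims(2)[OF J V] row_submatrix[OF J V]
    by (simp add: scalar_prod_def[of "submatrix V J UNIV *\<^sub>v y"] lessThan_atLeast0 power2_eq_square)
  also have "\<dots> = (\<Sum>j\<in>J. (Matrix.row V j \<bullet> y)\<^sup>2)"
    by (rule sum.reindex_bij_betw[OF bij_betw_pick]) (use J finite_subset in blast)
  finally show ?thesis .
qed

lemma scalar_prod_Cauchy:
  fixes x y :: "real Matrix.vec"
  assumes x: "x \<in> carrier_vec n" and y: "y \<in> carrier_vec n"
  shows "(x \<bullet> y)\<^sup>2 \<le> (x \<bullet> x) * (y \<bullet> y)"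
  using Cauchy_Schwarz_ineq_sum[of "\<lambda>i. x $ i" "\<lambda>i. y $ i" "{0..<n}"] x y
  by (simp add: scalar_prod_def power2_eq_square)

lemma transpose_mult_unit_vec:
  fixes V :: "real Matrix.mat"
  assumes V: "V \<in> carrier_mat n r" and i: "i < n"
  shows "transpose_mat V *\<^sub>v unit_vec n i = Matrix.row V i"
  using V i by (intro eq_vecI) (auto simp: scalar_prod_right_unit)

section \<open>Deterministic consequences of the eigenvalue bound, and the final probability
  estimate\<close>

lemma well_conditioned_sample:
  fixes L W_L S_L V_L :: "real Matrix.mat" and m n r k :: nat and mu1 mu2 s :: real
  assumes L: "L \<in> carrier_mat m n" and r: "r \<ge> 1" and svd: "compact_svd L W_L S_L V_L r"
    and mu1: "\<forall>i<m. vnorm2 (transpose_mat W_L *\<^sub>v unit_vec m i) \<le> sqrt (mu1 * r / m)"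
    and mu2: "\<forall>i<n. vnorm2 (transpose_mat V_L *\<^sub>v unit_vec n i) \<le> sqrt (mu2 * r / n)"
    and mu2_pos: "mu2 * r / n > 0"
    and J: "J \<subseteq> {..<n}" "card J = k" and k: "k > 0" and s: "s > 0"
    and low: "\<And>y. y \<in> carrier_vec r \<Longrightarrow> s * (y \<bullet> y) \<le> (\<Sum>j\<in>J. (Matrix.row V_L j \<bullet> y)\<^sup>2)"
  defines "C \<equiv> submatrix L UNIV J"
    and "beta \<equiv> sqrt (real k / real n) * spec_norm (pinv (submatrix V_L J UNIV))"
  shows "beta \<le> sqrt (k / n) / sqrt s"
    and "cond_num C \<le> beta * sqrt (mu2 * r) * cond_num L"
    and "compact_svd C W_C S_C V_C r' \<Longrightarrow> i < k \<Longrightarrow>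
      vnorm2 (transpose_mat V_C *\<^sub>v unit_vec k i) \<le> beta * cond_num L * sqrt (mu2 * r / k)"
    and "compact_svd C W_C S_C V_C r' \<Longrightarrow> i < m \<Longrightarrow>
      vnorm2 (transpose_mat W_C *\<^sub>v unit_vec m i) \<le> sqrt (mu1 * r / m)"
    and "compact_svd C W_C S_C V_C r' \<Longrightarrow> i < k \<Longrightarrow>
      vnorm2 (transpose_mat V_C *\<^sub>v unit_vec k i) \<le> sqrt (beta^2 * (cond_num L)^2 * mu2 * r / k)"
proof -
  note d = compact_svdD[OF svd L]
  define V where "V = submatrix V_L J UNIV"
  define \<rho> where "\<rho> = spec_norm (pinv V)"
  define U where "U = mu2 * r / n"
  \<comment> \<open>\<open>U\<close> bounds the squared row norms of V_L, so Cauchy-Schwarz on each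
    of the \<open>k\<close> sampled rows bounds the norm of V_L(J,:) by \<open>b\<close>.\<close>
  define b where "b = sqrt (k * U)"
  define smin where "smin = S_L $$ (r - 1, r - 1)"
  define smax where "smax = S_L $$ (0,0)"
  have V: "V \<in> carrier_mat k r" unfolding V_def using submatrix_dims(2)[OF J(1) d(3)] J(2) by simp
  have U: "U > 0" using mu2_pos unfolding U_def .
  have n: "n > 0" using U unfolding U_def by (cases n) auto
  have rowsq: "Matrix.row V_L j \<bullet> Matrix.row V_L j \<le> U" if "j < n" for j
  proof -
    have "vnorm2 (Matrix.row V_L j) \<le> sqrt U" using mu2 that transpose_mult_unit_vec[OF d(3) that] unfolding U_def by auto
    then have "sqrt (Matrix.row V_L j \<bullet> Matrix.row V_L j) \<le> sqrt U" unfolding vnorm2_scalar_prod .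
    then show ?thesis by simp
  qed
  have Vsq: "(V *\<^sub>v y) \<bullet> (V *\<^sub>v y) = (\<Sum>j\<in>J. (Matrix.row V_L j \<bullet> y)\<^sup>2)" for y
    unfolding V_def by (rule submatrix_mult_vec_sq[OF J(1) d(3)])
  have lowV: "s * (y \<bullet> y) \<le> (V *\<^sub>v y) \<bullet> (V *\<^sub>v y)" if "y \<in> carrier_vec r" for y
    using low[OF that] unfolding Vsq .
  have highV: "vnorm2 (V *\<^sub>v y) \<le> b * vnorm2 y" if y: "y \<in> carrier_vec r" for y
  proof -
    have "(Matrix.row V_L j \<bullet> y)\<^sup>2 \<le> U * (y \<bullet> y)" if "j \<in> J" for j
    proof -
      have j: "j < n" using J that by auto
      have "(Matrix.row V_L j \<bullet> y)\<^sup>2 \<le> (Matrix.row V_L j \<bullet> Matrix.row V_L j) * (y \<bullet> y)"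
        using d(3) j y by (intro scalar_prod_Cauchy[of _ r]) auto
      also have "\<dots> \<le> U * (y \<bullet> y)" using rowsq[OF j] scalar_prod_self_nonneg by (intro mult_right_mono) auto
      finally show ?thesis .
    qed
    then have "(V *\<^sub>v y) \<bullet> (V *\<^sub>v y) \<le> (\<Sum>j\<in>J. U * (y \<bullet> y))" unfolding Vsq by (rule sum_mono)
    then have "(V *\<^sub>v y) \<bullet> (V *\<^sub>v y) \<le> (k * U) * (y \<bullet> y)" using J(2) by simp
    then have "sqrt ((V *\<^sub>v y) \<bullet> (V *\<^sub>v y)) \<le> sqrt ((k * U) * (y \<bullet> y))" by (rule real_sqrt_le_mono)
    then show ?thesis unfolding b_def vnorm2_scalar_prod by (simp add: real_sqrt_mult)
  qed
  note sp = spec_norm_pinv[OF V s lowV, folded \<rho>_def]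
  have "C = W_L * S_L * transpose_mat V"
    unfolding C_def V_def d(9) using d(1,2,3) by (intro submatrix_mult_transpose[OF J(1)]) auto
  then interpret column_sample m k r W_L S_L V C \<rho> b smin smax
    by unfold_locales (use d(1,2,4,10) d(6) d(7)[of "r - 1"] d(7)[of 0] d(8) V sp(3) highV r in \<open>auto simp: smin_def smax_def\<close>)
  have kappa: "smax / smin \<le> cond_num L"
    unfolding smax_def smin_def using r by (intro cond_num_ge[OF svd L]) auto
  have kappa0: "cond_num L \<ge> 0" using kappa smin(1) smax(2) by (meson divide_nonneg_pos less_imp_le order_trans)
  have beta: "beta = sqrt (k / n) * \<rho>" unfolding beta_def V_def \<rho>_def ..
  have beta0: "beta \<ge> 0" unfolding beta using \<rho>_pos by simp
  show "beta \<le> sqrt (k / n) / sqrt s"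
    unfolding beta using mult_left_mono[OF sp(2), of "sqrt (k / n)"] by simp
  have "b * \<rho> * (smax / smin) \<le> b * \<rho> * cond_num L"
    using kappa \<rho>_pos U unfolding b_def by (intro mult_left_mono) auto
  \<comment> \<open>The factor sqrt (k/n) inside \<open>b\<close> is exactly the one by which \<rho>
    is scaled to \<open>beta\<close>.\<close>
  moreover have "b * \<rho> = beta * sqrt (mu2 * r)"
    unfolding b_def beta U_def by (simp add: real_sqrt_mult[symmetric] real_sqrt_divide mult_ac)
  ultimately show "cond_num C \<le> beta * sqrt (mu2 * r) * cond_num L"
    using cond_num_le by simp
  have step: "beta * cond_num L * sqrt (mu2 * r / k) = \<rho> * cond_num L * sqrt U"
  proof -
    have "sqrt (k / n) * sqrt (mu2 * r / k) = sqrt U" unfolding U_def using k by (simp flip: real_sqrt_mult)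
    then show ?thesis unfolding beta by (metis mult.assoc mult.commute)
  qed
  have item2: "vnorm2 (transpose_mat V_C *\<^sub>v unit_vec k i) \<le> beta * cond_num L * sqrt (mu2 * r / k)"
    if svdC: "compact_svd C W_C S_C V_C r'" and i: "i < k" for W_C S_C V_C r' i
  proof -
    have ij: "i < card J" using i J by simp
    have "transpose_mat V *\<^sub>v unit_vec k i = Matrix.row V_L (pick J i)"
      using transpose_mult_unit_vec[OF V i] row_submatrix[OF J(1) d(3) ij] unfolding V_def by simp
    moreover have "vnorm2 (Matrix.row V_L (pick J i)) \<le> sqrt U"
      unfolding vnorm2_scalar_prod using rowsq[OF pick_less(1)[OF J(1) ij]] by simp
    ultimately have "vnorm2 (transpose_mat V_C *\<^sub>v unit_vec k i) \<le> \<rho> * (smax / smin) * sqrt U"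
      using right_incoherence[OF svdC i] by simp
    also have "\<dots> \<le> \<rho> * cond_num L * sqrt U"
      using kappa \<rho>_pos U by (intro mult_right_mono mult_left_mono) auto
    finally show ?thesis unfolding step .
  qed
  show "vnorm2 (transpose_mat V_C *\<^sub>v unit_vec k i) \<le> beta * cond_num L * sqrt (mu2 * r / k)"
    if "compact_svd C W_C S_C V_C r'" "i < k" using item2[OF that] .
  have "beta * cond_num L * sqrt (mu2 * r / k) = sqrt (beta^2 * (cond_num L)^2 * mu2 * r / k)"
  proof -
    have "beta^2 * (cond_num L)^2 * mu2 * r / k = (beta * cond_num L)\<^sup>2 * (mu2 * r / k)"
      by (simp add: power_mult_distrib)
    moreover have "sqrt ((beta * cond_num L)\<^sup>2 * (mu2 * r / k)) = beta * cond_num L * sqrt (mu2 * r / k)"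
      using beta0 kappa0 by (simp only: real_sqrt_mult real_sqrt_abs) simp
    ultimately show ?thesis by (simp only:)
  qed
  then show "vnorm2 (transpose_mat V_C *\<^sub>v unit_vec k i) \<le> sqrt (beta^2 * (cond_num L)^2 * mu2 * r / k)"
    if "compact_svd C W_C S_C V_C r'" "i < k" using item2[OF that] by simp
  show "vnorm2 (transpose_mat W_C *\<^sub>v unit_vec m i) \<le> sqrt (mu1 * r / m)"
    if "compact_svd C W_C S_C V_C r'" "i < m"
    using left_incoherence[OF that] mu1 that(2) by (meson order_trans)
qed

lemma parseval_frame_rows:
  fixes V :: "real Matrix.mat"
  assumes V: "V \<in> carrier_mat n r" "transpose_mat V * V = 1\<^sub>m r" and r: "r \<ge> 1"
    and M: "\<forall>i<n. vnorm2 (transpose_mat V *\<^sub>v unit_vec n i) \<le> sqrt M"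
  shows "parseval_frame r n (Matrix.row V) M"
proof -
  have rows: "Matrix.row V j \<bullet> Matrix.row V j \<le> M" if "j < n" for j
    using M that transpose_mult_unit_vec[OF V(1) that] unfolding vnorm2_scalar_prod by auto
  have rc: "Matrix.row V j \<in> carrier_vec r" for j using V(1) by auto
  have parseval: "(\<Sum>j<n. (z \<bullet> Matrix.row V j) * (Matrix.row V j \<bullet> w)) = z \<bullet> w"
    if z: "z \<in> carrier_vec r" and w: "w \<in> carrier_vec r" for z w
  proof -
    have "(\<Sum>j<n. (z \<bullet> Matrix.row V j) * (Matrix.row V j \<bullet> w)) = (\<Sum>j<n. (Matrix.row V j \<bullet> z) * (Matrix.row V j \<bullet> w))"
      by (intro sum.cong refl) (simp add: comm_scalar_prod[OF z rc])
    also have "\<dots> = (V *\<^sub>v z) \<bullet> (V *\<^sub>v w)"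
      using V(1) by (simp add: scalar_prod_def[of "V *\<^sub>v z"] lessThan_atLeast0)
    finally show ?thesis using isometry_scalar_prod(2)[OF V z w] by simp
  qed
  \<comment> \<open>If \<open>M\<close> were nonpositive all rows would vanish, contradicting
    Parseval's identity at the first unit vector, which exists because r \<ge> 1.\<close>
  have "M > 0"
  proof (rule ccontr)
    assume "\<not> M > 0"
    then have "Matrix.row V j = 0\<^sub>v r" if "j < n" for j
      using rows[OF that] scalar_prod_self_nonneg[of "Matrix.row V j"] scalar_prod_self_eq_0[OF rc[of j]] by simp
    then have "(\<Sum>j<n. (unit_vec r 0 \<bullet> Matrix.row V j) * (Matrix.row V j \<bullet> unit_vec r 0)) = 0" by simp
    then show False using parseval[of "unit_vec r 0" "unit_vec r 0"] r by simp
  qed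
  then show ?thesis by unfold_locales (use rc rows parseval in auto)
qed

text \<open>This is ln x \<le> x - 1 at x = 1/(1 - \<delta>). The sign allows the sampling ratio
  k/(nM) in the exponent to be replaced by the smaller \<gamma>.\<close>

lemma entropy_nonneg:
  fixes \<delta> :: real
  assumes "\<delta> < 1"
  shows "\<delta> + (1 - \<delta>) * ln (1 - \<delta>) \<ge> 0"
proof -
  have "- ln (1 - \<delta>) \<le> inverse (1 - \<delta>) - 1"
    using ln_le_minus_one[of "inverse (1 - \<delta>)"] assms by (simp add: ln_inverse)
  then have "(1 - \<delta>) * - ln (1 - \<delta>) \<le> (1 - \<delta>) * (inverse (1 - \<delta>) - 1)"
    using assms by (intro mult_left_mono) auto
  also have "\<dots> = \<delta>" using assms by (simp add: field_simps)
  finally show ?thesis by simp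
qed

theorem theorem3p5:
  fixes L W_L S_L V_L :: "real Matrix.mat" and m n r k :: nat and mu1 mu2 gamma delta :: real
  assumes L: "L \<in> carrier_mat m n"
    and rank: "vec_space.rank m L = r"
    and r_pos: "r \<ge> 1"
    and svd: "compact_svd L W_L S_L V_L r"
    and mu1: "\<forall>i<m. vnorm2 (transpose_mat W_L *\<^sub>v unit_vec m i) \<le> sqrt (mu1 * r / m)"
    and mu2: "\<forall>i<n. vnorm2 (transpose_mat V_L *\<^sub>v unit_vec n i) \<le> sqrt (mu2 * r / n)"
    and gamma: "gamma > 0"
    and k_le: "k \<le> n"
    and k_ge: "real k \<ge> gamma * mu2 * r"
    and delta: "0 \<le> delta" "delta < 1"
  shows "measure_pmf.prob (pmf_of_set {J. J \<subseteq> {..<n} \<and> card J = k})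
     {J. let C = submatrix L UNIV J;
             beta = sqrt (real k / real n) * spec_norm (pinv (submatrix V_L J UNIV))
         in beta \<le> 1 / sqrt (1 - delta)
          \<and> cond_num C \<le> beta * sqrt (mu2 * r) * cond_num L
          \<and> (\<forall>r' W_C S_C V_C. compact_svd C W_C S_C V_C r' \<longrightarrow>
               (\<forall>i<k. vnorm2 (transpose_mat V_C *\<^sub>v unit_vec k i)
                        \<le> beta * cond_num L * sqrt (mu2 * r / k))
             \<and> (\<forall>i<m. vnorm2 (transpose_mat W_C *\<^sub>v unit_vec m i) \<le> sqrt (mu1 * r / m))
             \<and> (\<forall>i<k. vnorm2 (transpose_mat V_C *\<^sub>v unit_vec k i)
                        \<le> sqrt (beta^2 * (cond_num L)^2 * mu2 * r / k)))}
   \<ge> 1 - r / exp (gamma * (delta + (1 - delta) * ln (1 - delta)))"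
proof (cases "delta = 0")
  case True
  \<comment> \<open>The exponent vanishes here, so the claimed lower bound is 1 - r and hence
    nonpositive. The Chernoff bound requires \<delta> > 0.\<close>
  then show ?thesis using r_pos by (simp add: order_trans[OF _ measure_nonneg])
next
  case False
  define p where "p = pmf_of_set {J. J \<subseteq> {..<n} \<and> card J = k}"
  define g where "g = delta + (1 - delta) * ln (1 - delta)"
  define M where "M = mu2 * r / n"
  note d = compact_svdD[OF svd L]
  interpret parseval_frame r n "Matrix.row V_L" M
    by (rule parseval_frame_rows[OF d(3,5) r_pos]) (use mu2 M_def in simp)
  have n: "n > 0" using M_pos unfolding M_def by (cases n) auto
  have nM: "n * M = mu2 * r" unfolding M_def using n by simp
  have k: "real k \<ge> gamma * (n * M)" using k_ge unfolding nM by (simp add: mult.assoc)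
  then have k0: "k > 0" using gamma n M_pos by (metis less_le_trans mult_pos_pos of_nat_0_less_iff)
  define s where "s = (1 - delta) * k / n"
  have s: "s > 0" unfolding s_def using delta k0 n by simp
  \<comment> \<open>The bad event: the Gram matrix of the sampled rows has a Rayleigh quotient below
    (1 - \<delta>)k/n.\<close>
  let ?B = "{J. \<exists>y \<in> carrier_vec r. (\<Sum>j\<in>J. (Matrix.row V_L j \<bullet> y)\<^sup>2) < s * (y \<bullet> y)}"
  let ?E = "{J. let C = submatrix L UNIV J;
             beta = sqrt (real k / real n) * spec_norm (pinv (submatrix V_L J UNIV))
         in beta \<le> 1 / sqrt (1 - delta)
          \<and> cond_num C \<le> beta * sqrt (mu2 * r) * cond_num L
          \<and> (\<forall>r' W_C S_C V_C. compact_svd C W_C S_C V_C r' \<longrightarrow>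
               (\<forall>i<k. vnorm2 (transpose_mat V_C *\<^sub>v unit_vec k i)
                        \<le> beta * cond_num L * sqrt (mu2 * r / k))
             \<and> (\<forall>i<m. vnorm2 (transpose_mat W_C *\<^sub>v unit_vec m i) \<le> sqrt (mu1 * r / m))
             \<and> (\<forall>i<k. vnorm2 (transpose_mat V_C *\<^sub>v unit_vec k i)
                        \<le> sqrt (beta^2 * (cond_num L)^2 * mu2 * r / k)))}"
  have "measure_pmf.prob p ?B \<le> r * exp (- (k / (n * M) * g))"
    unfolding p_def g_def s_def using matrix_chernoff_lower[OF k_le n] delta False by simp
  also have "\<dots> \<le> r * exp (- (gamma * g))"
  proof -
    have "gamma \<le> k / (n * M)" using k n M_pos by (simp add: le_divide_eq)
    then have "gamma * g \<le> k / (n * M) * g"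
      using entropy_nonneg[OF delta(2)] unfolding g_def by (intro mult_right_mono)
    then show ?thesis by (intro mult_left_mono) auto
  qed
  finally have "measure_pmf.prob p ?B \<le> r / exp (gamma * g)" by (simp add: exp_minus divide_inverse)
  moreover have "measure_pmf.prob p (- ?B) = 1 - measure_pmf.prob p ?B"
    using measure_pmf.prob_compl[of ?B p] by (simp add: Compl_eq_Diff_UNIV)
  moreover have "measure_pmf.prob p (- ?B) \<le> measure_pmf.prob p ?E"
  proof -
    let ?F = "{J. J \<subseteq> {..<n} \<and> card J = k}"
    have "card ?F > 0" using n_subsets[of "{..<n}" k] k_le by simp
    then have "set_pmf p = ?F" unfolding p_def by (intro set_pmf_of_set) (auto simp: card_gt_0_iff)
    \<comment> \<open>The deterministic bounds concern only k-subsets of the index range, so the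
      complement of the bad event is first cut down to the support of the distribution.\<close>
    have sub: "- ?B \<inter> ?F \<subseteq> ?E"
    proof
      fix J assume J: "J \<in> - ?B \<inter> ?F"
      then have low: "s * (y \<bullet> y) \<le> (\<Sum>j\<in>J. (Matrix.row V_L j \<bullet> y)\<^sup>2)" if "y \<in> carrier_vec r" for y
        using that by force
      have JF: "J \<subseteq> {..<n}" "card J = k" using J by auto
      have "sqrt (k / n) / sqrt s = 1 / sqrt (1 - delta)"
        unfolding s_def using k0 n by (simp add: real_sqrt_divide real_sqrt_mult)
      with well_conditioned_sample[OF L r_pos svd mu1 mu2 M_pos[unfolded M_def] JF k0 s low]
      show "J \<in> ?E" unfolding Let_def by auto
    qed
    have "measure_pmf.prob p (- ?B) = measure_pmf.prob p (- ?B \<inter> ?F)"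
      using measure_Int_set_pmf[of p "- ?B"] \<open>set_pmf p = ?F\<close> by simp
    also have "\<dots> \<le> measure_pmf.prob p ?E" by (intro measure_pmf.finite_measure_mono sub) simp
    finally show ?thesis .
  qed
  ultimately show ?thesis unfolding p_def g_def by linarith
qed

end
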